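(* Let $n>6$ and let $\mathcal P=\{P_1,\dots,P_n\}\subset\mathbb{P}^2$ (over $\mathbb{C}$) be distinct points lying on a nondegenerate conic. For each $i\in\{6,\dots,n\}$ define $$\mathcal Q_i=\left\{Q_{i1}=\overline{P_1P_2}\cap\overline{P_4P_5},\ Q_{i2}=\overline{P_2P_3}\cap\overline{P_5P_i},\ Q_{i3}=\overline{P_3P_4}\cap\overline{P_iP_1}\right\},$$ and let $\mathcal Q=\bigcup_{i=6}^n\mathcal Q_i$ and $q=|\mathcal Q|$. Let $x_n$ be the point of $\mathrm{Gr}(3,n+q)$ given by the row span of a fixed $3\times(n+q)$ matrix whose columns are homogeneous coordinates of the points in $\mathcal P\cup\mathcal Q$. Then the ideal $I_{x_n}$ contains independent quartic polynomials (at least two) that are not in $N_{x_n}$.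
   Context: For $x\in \mathrm{Gr}(r,m)$ (the Grassmannian of $r$-dimensional subspaces of $\mathbb{C}^m$), let $A_x$ be any $r\times m$ matrix whose rows form a basis of the subspace $x$. $\mathscr{M}_x$ is the matroid on $\Omega_m=\{1,\dots,m\}$ whose bases are the sets $\lambda$ of $r$ indices such that the columns of $A_x$ indexed by $\lambda$ are linearly independent. $\Gamma_x=\{y\in \mathrm{Gr}(r,m): \mathscr{M}_y=\mathscr{M}_x\}$ and the matroid variety is the Zariski closure $\mathcal{V}_x=\overline{\Gamma_x}\subset \mathrm{Gr}(r,m)$. For an $r$-element subset $\lambda=\{\lambda_1<\dots<\lambda_r\}$ of $\Omega_m$, the bracket $[\lambda]=[\lambda_1\cdots\lambda_r]$ is the Plücker coordinate given by the $r\times r$ minor on the columns $\lambda_1,\dots,\lambda_r$. $\mathbb{C}[\mathrm{Gr}(r,m)]$ is the homogeneous coordinate ring of the Grassmannian in its Plücker embedding, i.e. the polynomial ring in the brackets modulo the ideal of Plücker relations, graded so that each bracket has degree $1$. A quartic polynomial is a homogeneous element of degree $4$ in the brackets. $I_x\subset\mathbb{C}[\mathrm{Gr}(r,m)]$ is the ideal of all elements vanishing on $\mathcal{V}_x$, and $N_x\subseteq I_x$ is the ideal generated by the brackets $[\lambda]$ with $\lambda$ an $r$-element subset of $\Omega_m$ that is not a basis of $\mathscr{M}_x$. A collection of elements of $\mathbb{C}[\mathrm{Gr}(r,m)]$ is called independent if none of them is a $\mathbb{C}[\mathrm{Gr}(r,m)]$-linear combination of the others (i.e. none lies in the ideal generated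 by the others). *)

theory Defs
  imports
    "Jordan_Normal_Form.DL_Submatrix"
    "Jordan_Normal_Form.VS_Connect"
    "HOL-Library.Poly_Mapping"
    "HOL-Algebra.QuotRing"
    "HOL.Hull"
begin

text \<open>
  Matrix columns are numbered from 0, as everywhere in the matrix library, so the ground set
  \<open>{1, ..., m}\<close> of the mathematical text appears here as \<open>{..<m}\<close>.
\<close>

subsection \<open>Grassmannians\<close>

abbreviation cvec :: "nat \<Rightarrow> (complex, complex vec) module" where
  "cvec m \<equiv> module_vec TYPE(complex) m"

abbreviation cspan :: "nat \<Rightarrow> complex vec set \<Rightarrow> complex vec set" where
  "cspan m S \<equiv> LinearCombinations.module.span class_ring (cvec m) S"

definition Gr :: "nat \<Rightarrow> nat \<Rightarrow> complex vec set set" where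
  "Gr r m = {x. VectorSpace.subspace class_ring x (cvec m) \<and>
                vectorspace.dim class_ring ((cvec m)\<lparr>carrier := x\<rparr>) = r}"

definition represents :: "nat \<Rightarrow> nat \<Rightarrow> complex mat \<Rightarrow> complex vec set \<Rightarrow> bool" where
  "represents r m A x \<longleftrightarrow> A \<in> carrier_mat r m \<and> distinct (rows A) \<and>
     vectorspace.basis class_ring ((cvec m)\<lparr>carrier := x\<rparr>) (set (rows A))"

definition r_subsets :: "nat \<Rightarrow> nat \<Rightarrow> nat set set" where
  "r_subsets r m = {J. J \<subseteq> {..<m} \<and> card J = r}"

text \<open>
  The columns indexed by \<open>J\<close> are independent as a family: repeated columns are excluded
  by injectivity, since linear dependence in the library is a property of sets. For
  \<open>x \<in> Gr r m\<close> the choice of the representing matrix is immaterial.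
\<close>

definition matroid_bases :: "nat \<Rightarrow> nat \<Rightarrow> complex vec set \<Rightarrow> nat set set" where
  "matroid_bases r m x = {J \<in> r_subsets r m. \<exists>A. represents r m A x \<and> inj_on (col A) J \<and>
     \<not> LinearCombinations.module.lin_dep class_ring (cvec r) (col A ` J)}"

subsection \<open>The homogeneous coordinate ring\<close>

text \<open>
  Polynomials in the brackets; the variable attached to an \<open>r\<close>-element set \<open>J\<close> stands for
  the bracket whose entries are the elements of \<open>J\<close> in increasing order.
\<close>

type_synonym bracket_poly = "(nat set \<Rightarrow>\<^sub>0 nat) \<Rightarrow>\<^sub>0 complex"

definition bracket_ring :: "nat \<Rightarrow> nat \<Rightarrow> bracket_poly ring" where
  "bracket_ring r m =
     \<lparr>carrier = {p. \<forall>t\<in>Poly_Mapping.keys p. Poly_Mapping.keys t \<subseteq> r_subsets r m},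
      mult = (*), one = 1, zero = 0, add = (+)\<rparr>"

definition bracket_var :: "nat set \<Rightarrow> bracket_poly" where
  "bracket_var J = Poly_Mapping.single (Poly_Mapping.single J 1) 1"

definition inversions :: "nat list \<Rightarrow> nat" where
  "inversions as = card {(i, j). i < j \<and> j < length as \<and> as ! i > as ! j}"

text \<open>
  The bracket of an arbitrary sequence of indices, reduced to increasing sequences by
  antisymmetry.
\<close>

definition bracket_seq :: "nat list \<Rightarrow> bracket_poly" where
  "bracket_seq as = (if distinct as then (- 1) ^ inversions as * bracket_var (set as) else 0)"

text \<open>
  The quadratic Pluecker relations: in the product of two brackets, the last entry of the
  first one is exchanged with the entries of the second one.
\<close>

definition plucker_relation :: "nat list \<Rightarrow> nat list \<Rightarrow> bracket_poly" where
  "plucker_relation as bs =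
     (\<Sum>k<length bs. (- 1) ^ k * bracket_seq (as @ [bs ! k]) *
                      bracket_seq (take k bs @ drop (Suc k) bs))"

definition plucker_ideal :: "nat \<Rightarrow> nat \<Rightarrow> bracket_poly set" where
  "plucker_ideal r m = genideal (bracket_ring r m)
     {plucker_relation as bs | as bs. set as \<subseteq> {..<m} \<and> set bs \<subseteq> {..<m} \<and>
        length as + 1 = r \<and> length bs = r + 1}"

definition coord_ring :: "nat \<Rightarrow> nat \<Rightarrow> bracket_poly set ring" where
  "coord_ring r m = bracket_ring r m Quot plucker_ideal r m"

definition residue_class :: "nat \<Rightarrow> nat \<Rightarrow> bracket_poly \<Rightarrow> bracket_poly set" where
  "residue_class r m p = plucker_ideal r m +>\<^bsub>bracket_ring r m\<^esub> p"

definition bracket :: "nat \<Rightarrow> nat \<Rightarrow> nat set \<Rightarrow> bracket_poly set" where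
  "bracket r m J = residue_class r m (bracket_var J)"

definition homogeneous :: "nat \<Rightarrow> nat \<Rightarrow> nat \<Rightarrow> bracket_poly set \<Rightarrow> bool" where
  "homogeneous r m d f \<longleftrightarrow> (\<exists>p \<in> carrier (bracket_ring r m). f = residue_class r m p \<and>
     (\<forall>t\<in>Poly_Mapping.keys p. (\<Sum>J\<in>Poly_Mapping.keys t. Poly_Mapping.lookup t J) = d))"

subsection \<open>Matroid varieties and their ideals\<close>

definition bracket_eval :: "complex mat \<Rightarrow> bracket_poly \<Rightarrow> complex" where
  "bracket_eval A p = (\<Sum>t\<in>Poly_Mapping.keys p. Poly_Mapping.lookup p t *
     (\<Prod>J\<in>Poly_Mapping.keys t. det (submatrix A UNIV J) ^ Poly_Mapping.lookup t J))"

text \<open>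
  All representatives of a residue class take the same value at a matrix. Quantifying over
  all representing matrices amounts to vanishing on the whole line in the affine cone over the
  Grassmannian, which makes sense for inhomogeneous elements as well.
\<close>

definition vanishes_at :: "nat \<Rightarrow> nat \<Rightarrow> bracket_poly set \<Rightarrow> complex vec set \<Rightarrow> bool" where
  "vanishes_at r m f x \<longleftrightarrow> (\<forall>A. represents r m A x \<longrightarrow> (\<forall>p\<in>f. bracket_eval A p = 0))"

definition zariski_closed :: "nat \<Rightarrow> nat \<Rightarrow> complex vec set set \<Rightarrow> bool" where
  "zariski_closed r m Z \<longleftrightarrow> (\<exists>F. (\<forall>f\<in>F. \<exists>d. homogeneous r m d f) \<and>
     Z = {x \<in> Gr r m. \<forall>f\<in>F. vanishes_at r m f x})"

definition matroid_stratum :: "nat \<Rightarrow> nat \<Rightarrow> complex vec set \<Rightarrow> complex vec set set" where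
  "matroid_stratum r m x = {y \<in> Gr r m. matroid_bases r m y = matroid_bases r m x}"

definition matroid_variety :: "nat \<Rightarrow> nat \<Rightarrow> complex vec set \<Rightarrow> complex vec set set" where
  "matroid_variety r m x = zariski_closed r m hull matroid_stratum r m x"

definition matroid_ideal :: "nat \<Rightarrow> nat \<Rightarrow> complex vec set \<Rightarrow> bracket_poly set set" where
  "matroid_ideal r m x = {f \<in> carrier (coord_ring r m).
     \<forall>y \<in> matroid_variety r m x. vanishes_at r m f y}"

definition nonbasis_ideal :: "nat \<Rightarrow> nat \<Rightarrow> complex vec set \<Rightarrow> bracket_poly set set" where
  "nonbasis_ideal r m x = genideal (coord_ring r m)
     (bracket r m ` (r_subsets r m - matroid_bases r m x))"

definition independent_elements :: "nat \<Rightarrow> nat \<Rightarrow> bracket_poly set set \<Rightarrow> bool" where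
  "independent_elements r m S \<longleftrightarrow> (\<forall>f\<in>S. f \<notin> genideal (coord_ring r m) (S - {f}))"

subsection \<open>The projective plane\<close>

abbreviation proj_plane :: "complex vec set set" where
  "proj_plane \<equiv> Gr 1 3"

definition proj_line :: "complex vec set \<Rightarrow> complex vec set \<Rightarrow> complex vec set set" where
  "proj_line a b = {s \<in> proj_plane. s \<subseteq> cspan 3 (a \<union> b)}"

definition nondegenerate_conic :: "complex vec set set \<Rightarrow> bool" where
  "nondegenerate_conic C \<longleftrightarrow> (\<exists>M \<in> carrier_mat 3 3. transpose_mat M = M \<and> det M \<noteq> 0 \<and>
     C = {p \<in> proj_plane. \<forall>v\<in>p. v \<bullet> (M *\<^sub>v v) = 0})"

text \<open>
  An intersection of two distinct lines is a one-element set; the union below therefore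
  consists of the three intersection points.
\<close>

definition pascal_points :: "(nat \<Rightarrow> complex vec set) \<Rightarrow> nat \<Rightarrow> complex vec set set" where
  "pascal_points P i =
     (proj_line (P 1) (P 2) \<inter> proj_line (P 4) (P 5)) \<union>
     (proj_line (P 2) (P 3) \<inter> proj_line (P 5) (P i)) \<union>
     (proj_line (P 3) (P 4) \<inter> proj_line (P i) (P 1))"

end

theory Submission
  imports Defs "Jordan_Normal_Form.DL_Rank"
begin

text \<open>
  For \<open>i = 6, ..., n\<close> let \<open>f\<^sub>i\<close> be the quartic \<open>[123][145][246][356] - [124][135][236][456]\<close> with
  the column of \<open>P\<^sub>i\<close> in the place of 6; it is the bracket condition for \<open>P\<^sub>1, ..., P\<^sub>5, P\<^sub>i\<close> to lie on
  a conic. These \<open>n - 5 \<ge> 2\<close> quartics have all the required properties.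

  They vanish on the matroid variety by Pascal's theorem and its converse. The three points of
  \<open>\<Q>\<^sub>i\<close> are the Pascal points of the hexagon \<open>P\<^sub>1 P\<^sub>2 P\<^sub>3 P\<^sub>4 P\<^sub>5 P\<^sub>i\<close>. As intersections of lines they
  are double cross products up to a scalar, and the determinant of the three double cross products
  is \<open>-f\<^sub>i\<close> (\<open>det3_line_meets\<close>). Hence the Pascal points are collinear if and only if
  \<open>f\<^sub>i = 0\<close>, provided that some brackets are nonzero (\<open>pascal_iff_conic\<close>). At \<open>x\<close> itself the conic gives
  \<open>f\<^sub>i = 0\<close> (\<open>conic_quartic_vanishes\<close>), so the Pascal points are collinear. This is a property of the
  matroid, as are the incidences that define the Pascal points and the nonvanishing of the brackets
  in question. So it holds at every point of the stratum, and there the converse direction gives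
  \<open>f\<^sub>i = 0\<close>; finally the zero locus of \<open>f\<^sub>i\<close> is closed (\<open>conic_quartic_in_matroid_ideal\<close>).

  That \<open>f\<^sub>i\<close> is neither in the ideal of the non-bases nor in the ideal of the other quartics is seen by
  evaluation at one matrix \<open>W\<^sub>i\<close> of size \<open>3 \<times> (n + q)\<close>. Evaluation is well defined on the coordinate
  ring, as minors satisfy the Pluecker relations (\<open>bracket_eval_plucker_relation\<close>). The columns of
  \<open>W\<^sub>i\<close> at \<open>P\<^sub>1, ..., P\<^sub>5, P\<^sub>i\<close> are six points not on a conic and all others are zero. Since no three points
  of a nondegenerate conic are collinear (\<open>conic_points_not_collinear\<close>), each non-basis
  involves a column outside \<open>P\<close>, so its bracket vanishes at \<open>W\<^sub>i\<close>. So does \<open>f\<^sub>k\<close> for \<open>k \<noteq> i\<close>, each term of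
  which involves the zero column at \<open>P\<^sub>k\<close>. But \<open>f\<^sub>i\<close> does not.
\<close>

section \<open>Brackets of vectors in three-space\<close>

definition det3 :: "complex vec \<Rightarrow> complex vec \<Rightarrow> complex vec \<Rightarrow> complex" where
  "det3 u v w = u $ 0 * (v $ 1 * w $ 2 - v $ 2 * w $ 1) - u $ 1 * (v $ 0 * w $ 2 - v $ 2 * w $ 0)
     + u $ 2 * (v $ 0 * w $ 1 - v $ 1 * w $ 0)"

text \<open>
  The classical bracket condition for six points of the plane to lie on a conic.
\<close>

definition conic_quartic ::
  "complex vec \<Rightarrow> complex vec \<Rightarrow> complex vec \<Rightarrow> complex vec \<Rightarrow> complex vec \<Rightarrow> complex vec \<Rightarrow> complex" where
  "conic_quartic a b c d e f =
     det3 a b c * det3 a d e * det3 b d f * det3 c e f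
     - det3 a b d * det3 a c e * det3 b c f * det3 d e f"

text \<open>
  The double cross product \<open>(a \<times> b) \<times> (c \<times> d)\<close>: homogeneous coordinates of the common point of
  the lines \<open>ab\<close> and \<open>cd\<close>.
\<close>

definition line_meet :: "complex vec \<Rightarrow> complex vec \<Rightarrow> complex vec \<Rightarrow> complex vec \<Rightarrow> complex vec" where
  "line_meet a b c d = det3 a b d \<cdot>\<^sub>v c - det3 a b c \<cdot>\<^sub>v d"

text \<open>
  The left-hand side is alternating in the four vectors \<open>c, d, e, f\<close> of a three-dimensional
  space, hence zero. Its terms are those of \<^const>\<open>plucker_relation\<close>.
\<close>

lemma det3_plucker: "det3 a b c * det3 d e f - det3 a b d * det3 c e f + det3 a b e * det3 c d f - det3 a b f * det3 c d e = 0"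
  unfolding det3_def by (simp add: algebra_simps)

lemma det3_cramer:
  assumes "i < 3"
  shows "det3 a b c * w $ i = det3 w b c * a $ i + det3 a w c * b $ i + det3 a b w * c $ i"
proof -
  have "i = 0 \<or> i = 1 \<or> i = 2" using assms by auto
  then show ?thesis by (elim disjE) (simp_all add: det3_def algebra_simps)
qed

text \<open>
  In coordinates with respect to the basis \<open>a, b, c\<close> the quartic is, up to the factor \<open>-[abc]\<^sup>2\<close>, the
  determinant with rows \<open>(xy, xz, yz)\<close> for the other three points. This determinant is the
  condition for a common conic because the conics through the coordinate points are exactly
  those without square terms.
\<close>

lemma conic_quartic_scaled:
  fixes a b c d e f
  defines "x \<equiv> \<lambda>w. det3 w b c" and "y \<equiv> \<lambda>w. det3 a w c" and "z \<equiv> \<lambda>w. det3 a b w"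
  shows "det3 a b c * (det3 a b c * conic_quartic a b c d e f) =
    - (x d * y d * (x e * z e * (y f * z f) - y e * z e * (x f * z f))
     - x d * z d * (x e * y e * (y f * z f) - y e * z e * (x f * y f))
     + y d * z d * (x e * y e * (x f * z f) - x e * z e * (x f * y f)))"
proof -
  let ?D = "det3 a b c"
  have 1: "?D * det3 a d e = y d * z e - z d * y e"
    unfolding x_def y_def z_def det3_def by (simp add: algebra_simps)
  have 2: "?D * det3 b d f = z d * x f - x d * z f"
    unfolding x_def y_def z_def det3_def by (simp add: algebra_simps)
  have 3: "?D * det3 c e f = x e * y f - y e * x f"
    unfolding x_def y_def z_def det3_def by (simp add: algebra_simps)
  have 4: "det3 a b d = z d" "det3 a c e = - y e" "det3 b c f = x f"
    unfolding x_def y_def z_def det3_def by (simp_all add: algebra_simps)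
  have "?D * det3 d e f = x d * det3 a e f + y d * det3 b e f + z d * det3 c e f"
    unfolding x_def y_def z_def det3_def by (simp add: algebra_simps)
  then have "?D * (?D * det3 d e f) = 
     x d * (?D * det3 a e f) + y d * (?D * det3 b e f) + z d * (?D * det3 c e f)"
    by (simp add: algebra_simps)
  moreover have "?D * det3 a e f = y e * z f - z e * y f"
    unfolding x_def y_def z_def det3_def by (simp add: algebra_simps)
  moreover have "?D * det3 b e f = z e * x f - x e * z f"
    unfolding x_def y_def z_def det3_def by (simp add: algebra_simps)
  ultimately have 7: "?D * (?D * det3 d e f) = x d * (y e * z f - z e * y f)
     + y d * (z e * x f - x e * z f) + z d * (x e * y f - y e * x f)"
    using 3 by simp
  have "?D * (?D * conic_quartic a b c d e f) =
      (?D * det3 a d e) * (?D * det3 b d f) * (?D * det3 c e f)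
      - det3 a b d * det3 a c e * det3 b c f * (?D * (?D * det3 d e f))"
    unfolding conic_quartic_def by (simp add: algebra_simps)
  also have "\<dots> = (y d * z e - z d * y e) * (z d * x f - x d * z f) * (x e * y f - y e * x f)
     + z d * y e * x f * (x d * (y e * z f - z e * y f)
     + y d * (z e * x f - x e * z f) + z d * (x e * y f - y e * x f))"
    unfolding 1 2 3 4 7 by simp
  finally show ?thesis by (simp add: algebra_simps)
qed

lemma det3_linear:
  assumes "u \<in> carrier_vec 3" "v \<in> carrier_vec 3"
  shows "det3 (u - v) x y = det3 u x y - det3 v x y"
    and "det3 x (u - v) y = det3 x u y - det3 x v y"
    and "det3 x y (u - v) = det3 x y u - det3 x y v"
    and "det3 (r \<cdot>\<^sub>v u) x y = r * det3 u x y"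
    and "det3 x (r \<cdot>\<^sub>v u) y = r * det3 x u y"
    and "det3 x y (r \<cdot>\<^sub>v u) = r * det3 x y u"
  using assms by (simp_all add: det3_def algebra_simps)

lemma det3_alternating [simp]:
  "det3 u u v = 0" "det3 u v u = 0" "det3 v u u = 0"
  by (simp_all add: det3_def algebra_simps)

lemma det3_swap: "det3 v u w = - det3 u v w" "det3 u w v = - det3 u v w"
  by (simp_all add: det3_def algebra_simps)

lemma det3_plucker3: "det3 a b c * det3 a d e = det3 a b d * det3 a c e - det3 a b e * det3 a c d"
  by (simp add: det3_def algebra_simps)

text \<open>
  The algebraic core of Pascal's theorem: the three Pascal points of the hexagon \<open>abcdef\<close> have
  the conic quartic as their bracket. Expanding by linearity leaves four terms, which three-term
  Pluecker relations reduce to the two of the quartic.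
\<close>

lemma det3_line_meets: 
  assumes "a \<in> carrier_vec 3" "b \<in> carrier_vec 3" "c \<in> carrier_vec 3" "d \<in> carrier_vec 3" 
    "e \<in> carrier_vec 3" "f \<in> carrier_vec 3"
  shows "det3 (line_meet a b d e) (line_meet b c e f) (line_meet c d f a) = - conic_quartic a b c d e f"
proof -
  have "det3 (line_meet a b d e) (line_meet b c e f) (line_meet c d f a) =
     det3 a b e * det3 b c f * det3 c d a * det3 d e f - det3 a b e * det3 b c f * det3 c d f * det3 d e a
     + det3 a b e * det3 b c e * det3 c d f * det3 d f a - det3 a b d * det3 b c e * det3 c d f * det3 e f a"
    using assms by (simp add: line_meet_def det3_linear algebra_simps)
  also have "\<dots> = det3 a b e * det3 b c f * det3 c d a * det3 d e f 
     + det3 c d f * (det3 b c e * (det3 a b e * det3 d f a - det3 a b d * det3 e f a)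
          - det3 a b e * det3 b c f * det3 d e a)"
    by (simp add: algebra_simps)
  also have "det3 a b e * det3 d f a - det3 a b d * det3 e f a = det3 a b f * det3 d e a"
    by (simp add: det3_def algebra_simps)
  also have "det3 b c e * (det3 a b f * det3 d e a) - det3 a b e * det3 b c f * det3 d e a 
     = det3 d e a * (det3 b c e * det3 a b f - det3 a b e * det3 b c f)"
    by (simp add: algebra_simps)
  also have "det3 b c e * det3 a b f - det3 a b e * det3 b c f = - (det3 a b c * det3 b e f)"
    by (simp add: det3_def algebra_simps)
  also have "det3 a b e * det3 b c f * det3 c d a * det3 d e f = (det3 a b e * det3 c d a) * (det3 b c f * det3 d e f)"
    by (simp add: algebra_simps)
  also have "det3 a b e * det3 c d a = det3 a b d * det3 a c e - det3 a b c * det3 a d e"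
    by (simp add: det3_def algebra_simps)
  also have "(det3 a b d * det3 a c e - det3 a b c * det3 a d e) * (det3 b c f * det3 d e f)
     = det3 a b d * det3 a c e * det3 b c f * det3 d e f - det3 a b c * det3 a d e * (det3 b c f * det3 d e f)"
    by (simp add: algebra_simps)
  also have "det3 b c f * det3 d e f = det3 b d f * det3 c e f - det3 b e f * det3 c d f"
    by (simp add: det3_def algebra_simps)
  also have "det3 d e a = det3 a d e"
    by (simp add: det3_def algebra_simps)
  finally show ?thesis
    by (simp add: conic_quartic_def algebra_simps)
qed

section \<open>Determinants of three-by-three matrices\<close>

lemma det_2:
  assumes B: "B \<in> carrier_mat 2 2"
  shows "det B = B $$ (0, 0) * B $$ (1, 1) - B $$ (0, 1) * B $$ (1, 0)"
proof -
  have [simp]: "det (mat (Suc 0) (Suc 0) f) = f (0, 0)" for f :: "nat \<times> nat \<Rightarrow> 'a::comm_ring_1"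
    by (subst det_single) auto
  show ?thesis
    using B unfolding laplace_expansion_column[OF B, of 0, simplified]
    by (simp add: cofactor_def mat_delete_def numeral_2_eq_2 mult.commute)
qed

lemma det_3_cols:
  assumes A: "A \<in> carrier_mat 3 3"
  shows "det A = det3 (col A 0) (col A 1) (col A 2)"
proof -
  have det: "det (mat_delete A i 0) =
     mat_delete A i 0 $$ (0, 0) * mat_delete A i 0 $$ (1, 1) -
     mat_delete A i 0 $$ (0, 1) * mat_delete A i 0 $$ (1, 0)" for i
    by (rule det_2) (use A in \<open>auto simp: mat_delete_def\<close>)
  have "det A = (\<Sum>i<3. A $$ (i, 0) * cofactor A i 0)"
    by (rule laplace_expansion_column[OF A]) simp
  also have "\<dots> = A $$ (0, 0) * det (mat_delete A 0 0) - A $$ (1, 0) * det (mat_delete A 1 0)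
      + A $$ (2, 0) * det (mat_delete A 2 0)"
    by (simp add: cofactor_def eval_nat_numeral)
  also have "\<dots> = det3 (col A 0) (col A 1) (col A 2)"
    unfolding det det3_def using A by (simp add: mat_delete_def eval_nat_numeral algebra_simps)
  finally show ?thesis .
qed

lemma det_mat_of_cols_3:
  assumes "u \<in> carrier_vec 3" "v \<in> carrier_vec 3" "w \<in> carrier_vec 3"
  shows "det (mat_of_cols 3 [u, v, w]) = det3 u v w"
proof -
  have "mat_of_cols 3 [u, v, w] \<in> carrier_mat 3 3"
    using mat_of_cols_carrier(1)[of 3 "[u, v, w]"] by (simp add: eval_nat_numeral)
  from det_3_cols[OF this] show ?thesis 
    using assms by (simp add: numeral_2_eq_2 numeral_3_eq_3)
qed

lemma det3_mult_mat:
  assumes G: "G \<in> carrier_mat 3 3"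
    and c: "u \<in> carrier_vec 3" "v \<in> carrier_vec 3" "w \<in> carrier_vec 3"
  shows "det3 (G *\<^sub>v u) (G *\<^sub>v v) (G *\<^sub>v w) = det G * det3 u v w"
proof -
  let ?U = "mat_of_cols 3 [u, v, w]"
  have U: "?U \<in> carrier_mat 3 3"
    using mat_of_cols_carrier(1)[of 3 "[u, v, w]"] by (simp add: eval_nat_numeral)
  have "det G * det3 u v w = det (G * ?U)"
    using det_mult[OF G U] det_mat_of_cols_3[OF c] by simp
  also have "G * ?U \<in> carrier_mat 3 3" using G U by auto
  from det_3_cols[OF this] have "det (G * ?U) = det3 (col (G * ?U) 0) (col (G * ?U) 1) (col (G * ?U) 2)" .
  also have "\<dots> = det3 (G *\<^sub>v u) (G *\<^sub>v v) (G *\<^sub>v w)"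
    using col_mult2[OF G U] c by (simp add: numeral_2_eq_2 numeral_3_eq_3)
  finally show ?thesis by simp
qed

section \<open>Pascal's theorem and its converse\<close>

text \<open>
  A vector on two different lines is proportional to their \<^const>\<open>line_meet\<close>; the factor is explicit
  and consists of brackets, so that its vanishing can be read off from a matroid.
\<close>

lemma line_meet_unique:
  assumes c: "a \<in> carrier_vec 3" "b \<in> carrier_vec 3" "c \<in> carrier_vec 3" "d \<in> carrier_vec 3" "q \<in> carrier_vec 3"
    and abq: "det3 a b q = 0" and cdq: "det3 c d q = 0"
  shows "(det3 a c d * det3 a b d) \<cdot>\<^sub>v q = det3 a q d \<cdot>\<^sub>v line_meet a b c d"
proof (rule eq_vecI)
  fix i assume "i < dim_vec (det3 a q d \<cdot>\<^sub>v line_meet a b c d)"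
  then have i: "i < 3" using c by (simp add: line_meet_def)
  have "det3 q c d = 0" using cdq by (simp add: det3_def algebra_simps)
  then have 1: "det3 a c d * q $ i = det3 a q d * c $ i + det3 a c q * d $ i"
    using det3_cramer[OF i, of a c d q] by simp
  have 2: "det3 a b d * det3 a c q = - (det3 a q d * det3 a b c)"
    using det3_plucker3[of a b c d q] abq det3_swap(2)[of a q d] by (simp add: mult.commute)
  have "det3 a c d * det3 a b d * q $ i = det3 a b d * (det3 a c d * q $ i)" by simp
  also have "\<dots> = det3 a q d * (det3 a b d * c $ i) + (det3 a b d * det3 a c q) * d $ i"
    unfolding 1 by (simp add: algebra_simps)
  also have "\<dots> = det3 a q d * (det3 a b d * c $ i - det3 a b c * d $ i)"
    unfolding 2 by (simp add: algebra_simps)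
  finally show "((det3 a c d * det3 a b d) \<cdot>\<^sub>v q) $ i = (det3 a q d \<cdot>\<^sub>v line_meet a b c d) $ i"
    using c i by (simp add: line_meet_def)
qed (use c in \<open>simp add: line_meet_def\<close>)

text \<open>
  Pascal's theorem together with its converse. The Pascal points are characterized by
  incidences only, hence known up to scalars, and the brackets required to be nonzero are those
  that occur in these scalars.
\<close>

lemma pascal_iff_conic:
  assumes c: "a \<in> carrier_vec 3" "b \<in> carrier_vec 3" "c \<in> carrier_vec 3" "d \<in> carrier_vec 3"
    "e \<in> carrier_vec 3" "f \<in> carrier_vec 3"
    "p \<in> carrier_vec 3" "q \<in> carrier_vec 3" "r \<in> carrier_vec 3"
    and p: "det3 a b p = 0" "det3 d e p = 0" "det3 a d e \<noteq> 0" "det3 a b e \<noteq> 0" "det3 a p e \<noteq> 0"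
    and q: "det3 b c q = 0" "det3 e f q = 0" "det3 b e f \<noteq> 0" "det3 b c f \<noteq> 0" "det3 b q f \<noteq> 0"
    and r: "det3 c d r = 0" "det3 f a r = 0" "det3 c f a \<noteq> 0" "det3 c d a \<noteq> 0" "det3 c r a \<noteq> 0"
  shows "det3 p q r = 0 \<longleftrightarrow> conic_quartic a b c d e f = 0"
proof -
  let ?P = "line_meet a b d e" and ?Q = "line_meet b c e f" and ?R = "line_meet c d f a"
  have m: "?P \<in> carrier_vec 3" "?Q \<in> carrier_vec 3" "?R \<in> carrier_vec 3"
    using c by (auto simp: line_meet_def)
  have "(det3 a d e * det3 a b e) * (det3 b e f * det3 b c f) * (det3 c f a * det3 c d a) * det3 p q r
     = det3 ((det3 a d e * det3 a b e) \<cdot>\<^sub>v p) ((det3 b e f * det3 b c f) \<cdot>\<^sub>v q) ((det3 c f a * det3 c d a) \<cdot>\<^sub>v r)"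
    using c by (simp add: det3_linear)
  also have "\<dots> = det3 (det3 a p e \<cdot>\<^sub>v ?P) (det3 b q f \<cdot>\<^sub>v ?Q) (det3 c r a \<cdot>\<^sub>v ?R)"
    using line_meet_unique[OF c(1,2,4,5,7) p(1,2)] line_meet_unique[OF c(2,3,5,6,8) q(1,2)]
      line_meet_unique[OF c(3,4,6,1,9) r(1,2)] by simp
  also have "\<dots> = det3 a p e * det3 b q f * det3 c r a * det3 ?P ?Q ?R"
    using m by (simp add: det3_linear)
  also have "det3 ?P ?Q ?R = - conic_quartic a b c d e f"
    using c by (intro det3_line_meets)
  finally show ?thesis using p q r by auto
qed

section \<open>Points on a nondegenerate conic\<close>

lemma bilinear_sym:
  fixes M :: "complex mat"
  assumes M: "M \<in> carrier_mat 3 3" "M\<^sup>T = M" and u: "u \<in> carrier_vec 3" and v: "v \<in> carrier_vec 3"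
  shows "v \<bullet> (M *\<^sub>v u) = u \<bullet> (M *\<^sub>v v)"
proof -
  have "v \<bullet> (M *\<^sub>v u) = (M\<^sup>T *\<^sub>v v) \<bullet> u"
    by (rule transpose_vec_mult_scalar[OF M(1) u v, symmetric])
  also have "\<dots> = u \<bullet> (M *\<^sub>v v)"
    unfolding M(2) by (rule comm_scalar_prod[of _ 3]) (use M u v in auto)
  finally show ?thesis .
qed

lemma quadratic_form_combination:
  fixes M :: "complex mat" and x y z :: complex
  assumes M: "M \<in> carrier_mat 3 3" "M\<^sup>T = M" 
    and c: "a \<in> carrier_vec 3" "b \<in> carrier_vec 3" "c \<in> carrier_vec 3"
  defines "t \<equiv> x \<cdot>\<^sub>v a + y \<cdot>\<^sub>v b + z \<cdot>\<^sub>v c"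
  shows "t \<bullet> (M *\<^sub>v t) = x\<^sup>2 * (a \<bullet> (M *\<^sub>v a)) + y\<^sup>2 * (b \<bullet> (M *\<^sub>v b)) + z\<^sup>2 * (c \<bullet> (M *\<^sub>v c))
    + 2 * (x * y * (a \<bullet> (M *\<^sub>v b)) + x * z * (a \<bullet> (M *\<^sub>v c)) + y * z * (b \<bullet> (M *\<^sub>v c)))"
proof -
  have Mc: "M *\<^sub>v a \<in> carrier_vec 3" "M *\<^sub>v b \<in> carrier_vec 3" "M *\<^sub>v c \<in> carrier_vec 3"
    using M c by auto
  have "M *\<^sub>v t = x \<cdot>\<^sub>v (M *\<^sub>v a) + y \<cdot>\<^sub>v (M *\<^sub>v b) + z \<cdot>\<^sub>v (M *\<^sub>v c)"
    using M c Mc unfolding t_def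
    by (simp add: mult_add_distrib_mat_vec[of _ 3 3] mult_mat_vec[of _ 3 3] del: assoc_add_vec)
  then show ?thesis
    using c Mc unfolding t_def
    by (simp add: add_scalar_prod_distrib[of _ 3] scalar_prod_add_distrib[of _ 3]
        bilinear_sym[OF M c(1,2)] bilinear_sym[OF M c(1,3)] bilinear_sym[OF M c(2,3)] power2_eq_square algebra_simps)
qed

text \<open>
  The Gram matrix of \<open>u, v, w\<close> is \<open>U\<^sup>T M U\<close>, where \<open>U\<close> has the columns \<open>u, v, w\<close>.
\<close>

lemma gram_det:
  assumes M: "M \<in> carrier_mat 3 3"
    and c: "u \<in> carrier_vec 3" "v \<in> carrier_vec 3" "w \<in> carrier_vec 3"
  defines "g \<equiv> \<lambda>x. vec_of_list [u \<bullet> (M *\<^sub>v x), v \<bullet> (M *\<^sub>v x), w \<bullet> (M *\<^sub>v x)]"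
  shows "det3 (g u) (g v) (g w) = (det3 u v w)\<^sup>2 * det M"
proof -
  let ?U = "mat_of_cols 3 [u, v, w]"
  have U: "?U \<in> carrier_mat 3 3" 
    using mat_of_cols_carrier(1)[of 3 "[u, v, w]"] by (simp add: eval_nat_numeral)
  have g: "g x = ?U\<^sup>T *\<^sub>v (M *\<^sub>v x)" if "x \<in> carrier_vec 3" for x
  proof (rule eq_vecI)
    fix i assume "i < dim_vec (?U\<^sup>T *\<^sub>v (M *\<^sub>v x))"
    then have "i = 0 \<or> i = 1 \<or> i = 2" by auto
    then show "g x $ i = (?U\<^sup>T *\<^sub>v (M *\<^sub>v x)) $ i"
      using c by (elim disjE) (simp_all add: g_def row_transpose numeral_2_eq_2 numeral_3_eq_3)
  qed (simp add: g_def)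
  have Mx: "M *\<^sub>v u \<in> carrier_vec 3" "M *\<^sub>v v \<in> carrier_vec 3" "M *\<^sub>v w \<in> carrier_vec 3" using M c by auto
  have UT: "?U\<^sup>T \<in> carrier_mat 3 3" using U by auto
  have "det3 (g u) (g v) (g w) = det (?U\<^sup>T) * det3 (M *\<^sub>v u) (M *\<^sub>v v) (M *\<^sub>v w)"
    unfolding g[OF c(1)] g[OF c(2)] g[OF c(3)] by (rule det3_mult_mat[OF UT Mx])
  also have "\<dots> = det3 u v w * (det M * det3 u v w)"
    by (subst det3_mult_mat[OF M c], subst det_transpose[OF U], subst det_mat_of_cols_3[OF c], rule refl)
  finally show ?thesis by (simp add: power2_eq_square)
qed

lemma cramer_vec:
  assumes "a \<in> carrier_vec 3" "b \<in> carrier_vec 3" "c \<in> carrier_vec 3" "w \<in> carrier_vec 3"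
  shows "det3 a b c \<cdot>\<^sub>v w = det3 w b c \<cdot>\<^sub>v a + det3 a w c \<cdot>\<^sub>v b + det3 a b w \<cdot>\<^sub>v c"
  using assms det3_cramer[of _ a b c w] by (intro eq_vecI) auto

lemma quadratic_form_cramer:
  fixes M :: "complex mat"
  assumes M: "M \<in> carrier_mat 3 3" "M\<^sup>T = M"
    and c: "a \<in> carrier_vec 3" "b \<in> carrier_vec 3" "c \<in> carrier_vec 3" "w \<in> carrier_vec 3"
    and 0: "a \<bullet> (M *\<^sub>v a) = 0" "b \<bullet> (M *\<^sub>v b) = 0" "w \<bullet> (M *\<^sub>v w) = 0"
  defines "x \<equiv> det3 w b c" and "y \<equiv> det3 a w c" and "z \<equiv> det3 a b w"
  shows "2 * (x * y * (a \<bullet> (M *\<^sub>v b)) + x * z * (a \<bullet> (M *\<^sub>v c)) + y * z * (b \<bullet> (M *\<^sub>v c)))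
    + z\<^sup>2 * (c \<bullet> (M *\<^sub>v c)) = 0"
proof -
  define t where "t = det3 a b c \<cdot>\<^sub>v w"
  have "t \<bullet> (M *\<^sub>v t) = (det3 a b c)\<^sup>2 * (w \<bullet> (M *\<^sub>v w))"
    using M c by (simp add: t_def mult_mat_vec[of _ 3 3] power2_eq_square)
  moreover have "t = x \<cdot>\<^sub>v a + y \<cdot>\<^sub>v b + z \<cdot>\<^sub>v c"
    unfolding t_def x_def y_def z_def by (rule cramer_vec[OF c])
  ultimately show ?thesis
    using quadratic_form_combination[OF M c(1-3), of x y z] 0 by (simp add: ac_simps)
qed

text \<open>
  Two different points of a nondegenerate conic are not conjugate: otherwise the Gram matrix of
  \<open>u, v, w\<close> would have a vanishing upper left block of size two and so determinant zero.
\<close>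

lemma polar_nonzero:
  fixes M :: "complex mat"
  assumes M: "M \<in> carrier_mat 3 3" "M\<^sup>T = M" "det M \<noteq> 0"
    and c: "u \<in> carrier_vec 3" "v \<in> carrier_vec 3" "w \<in> carrier_vec 3"
    and 0: "u \<bullet> (M *\<^sub>v u) = 0" "v \<bullet> (M *\<^sub>v v) = 0"
    and ind: "det3 u v w \<noteq> 0"
  shows "u \<bullet> (M *\<^sub>v v) \<noteq> 0"
proof
  assume uv: "u \<bullet> (M *\<^sub>v v) = 0"
  then have "v \<bullet> (M *\<^sub>v u) = 0" using bilinear_sym[OF M(1,2) c(1,2)] by simp
  then have "(det3 u v w)\<^sup>2 * det M = 0"
    unfolding gram_det[OF M(1) c, symmetric] using 0 uv by (simp add: det3_def)
  then show False using M ind by simp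
qed

text \<open>
  If \<open>w = \<alpha>u + \<beta>v\<close> with all three points on the conic, the quadratic form gives
  \<open>2\<alpha>\<beta>\<langle>u, v\<rangle> = 0\<close>, so by \<open>polar_nonzero\<close> \<open>w\<close> is one of the points \<open>u\<close> and \<open>v\<close>.
\<close>

lemma conic_points_not_collinear:
  fixes M :: "complex mat"
  assumes M: "M \<in> carrier_mat 3 3" "M\<^sup>T = M" "det M \<noteq> 0"
    and c: "u \<in> carrier_vec 3" "v \<in> carrier_vec 3" "w \<in> carrier_vec 3"
    and 0: "u \<bullet> (M *\<^sub>v u) = 0" "v \<bullet> (M *\<^sub>v v) = 0" "w \<bullet> (M *\<^sub>v w) = 0"
    and uv: "\<exists>y\<in>carrier_vec 3. det3 u v y \<noteq> 0"
    and vw: "\<exists>y\<in>carrier_vec 3. det3 v w y \<noteq> 0"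
    and uw: "\<exists>y\<in>carrier_vec 3. det3 u w y \<noteq> 0"
  shows "det3 u v w \<noteq> 0"
proof
  assume D: "det3 u v w = 0"
  from uv obtain y where y: "y \<in> carrier_vec 3" and uvy: "det3 u v y \<noteq> 0" by blast
  have "u \<bullet> (M *\<^sub>v v) \<noteq> 0" by (rule polar_nonzero[OF M c(1,2) y 0(1,2) uvy])
  moreover have "det3 w v y * det3 u w y * (u \<bullet> (M *\<^sub>v v)) = 0"
    using quadratic_form_cramer[OF M(1,2) c(1,2) y c(3) 0] D by simp
  moreover have w: "det3 u v y \<cdot>\<^sub>v w = det3 w v y \<cdot>\<^sub>v u + det3 u w y \<cdot>\<^sub>v v"
    unfolding cramer_vec[OF c(1,2) y c(3)] D using c y by (intro eq_vecI) auto
  ultimately consider "det3 w v y = 0" | "det3 u w y = 0" by auto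
  then show False
  proof cases
    case 1
    then have "det3 u v y \<cdot>\<^sub>v w = det3 u w y \<cdot>\<^sub>v v" unfolding w 1 using c by (intro eq_vecI) auto
    then have "det3 v (det3 u v y \<cdot>\<^sub>v w) z = det3 v (det3 u w y \<cdot>\<^sub>v v) z" for z by simp
    then have "det3 u v y * det3 v w z = 0" for z using c by (simp add: det3_linear)
    then show False using vw uvy by auto
  next
    case 2
    then have "det3 u v y \<cdot>\<^sub>v w = det3 w v y \<cdot>\<^sub>v u" unfolding w 2 using c by (intro eq_vecI) auto
    then have "det3 u (det3 u v y \<cdot>\<^sub>v w) z = det3 u (det3 w v y \<cdot>\<^sub>v u) z" for z by simp
    then have "det3 u v y * det3 u w z = 0" for z using c by (simp add: det3_linear)
    then show False using uw uvy by auto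
  qed
qed

text \<open>
  Up to the factor 2 the conic is \<open>pxy + qxz + ryz\<close> in the basis \<open>a, b, c\<close>, and its coefficient vector is
  in the kernel of the matrix from \<open>conic_quartic_scaled\<close>. It is nonzero since already \<open>p\<close> is.
\<close>

lemma conic_quartic_vanishes:
  fixes M :: "complex mat"
  assumes M: "M \<in> carrier_mat 3 3" "M\<^sup>T = M" "det M \<noteq> 0"
    and c: "a \<in> carrier_vec 3" "b \<in> carrier_vec 3" "c \<in> carrier_vec 3"
      "d \<in> carrier_vec 3" "e \<in> carrier_vec 3" "f \<in> carrier_vec 3"
    and 0: "a \<bullet> (M *\<^sub>v a) = 0" "b \<bullet> (M *\<^sub>v b) = 0" "c \<bullet> (M *\<^sub>v c) = 0"
      "d \<bullet> (M *\<^sub>v d) = 0" "e \<bullet> (M *\<^sub>v e) = 0" "f \<bullet> (M *\<^sub>v f) = 0"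
    and abc: "det3 a b c \<noteq> 0"
  shows "conic_quartic a b c d e f = 0"
proof -
  define x y z where "x = (\<lambda>w. det3 w b c)" and "y = (\<lambda>w. det3 a w c)" and "z = (\<lambda>w. det3 a b w)"
  define p q r where "p = a \<bullet> (M *\<^sub>v b)" and "q = a \<bullet> (M *\<^sub>v c)" and "r = b \<bullet> (M *\<^sub>v c)"
  have p0: "p \<noteq> 0" unfolding p_def by (rule polar_nonzero[OF M c(1-3) 0(1,2) abc])
  have rel: "p * (x w * y w) = - (q * (x w * z w) + r * (y w * z w))"
    if "w \<in> carrier_vec 3" "w \<bullet> (M *\<^sub>v w) = 0" for w
  proof -
    have "2 * (x w * y w * p + x w * z w * q + y w * z w * r) = 0"
      using quadratic_form_cramer[OF M(1,2) c(1-3) that(1) 0(1,2) that(2)] 0(3)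
      unfolding x_def y_def z_def p_def q_def r_def by simp
    then have "(x w * y w * p + x w * z w * q) + y w * z w * r = 0"
      unfolding mult_eq_0_iff by simp
    then show ?thesis by (simp add: eq_neg_iff_add_eq_0 algebra_simps)
  qed
  \<comment> \<open>Multiplying the first column by \<open>p\<close> makes it a combination of the other two.\<close>
  have "p * (det3 a b c * (det3 a b c * conic_quartic a b c d e f)) =
    - ((p * (x d * y d)) * (x e * z e * (y f * z f) - y e * z e * (x f * z f))
     - x d * z d * ((p * (x e * y e)) * (y f * z f) - y e * z e * (p * (x f * y f)))
     + y d * z d * ((p * (x e * y e)) * (x f * z f) - x e * z e * (p * (x f * y f))))"
    unfolding conic_quartic_scaled x_def y_def z_def by (simp add: algebra_simps)
  also have "\<dots> = 0"
    unfolding rel[OF c(4) 0(4)] rel[OF c(5) 0(5)] rel[OF c(6) 0(6)] by (simp add: algebra_simps)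
  finally show ?thesis using p0 abc by simp
qed

section \<open>Evaluation of bracket polynomials at a matrix\<close>

definition monomial_eval :: "complex mat \<Rightarrow> (nat set \<Rightarrow>\<^sub>0 nat) \<Rightarrow> complex" where
  "monomial_eval A t = (\<Prod>J\<in>Poly_Mapping.keys t. det (submatrix A UNIV J) ^ Poly_Mapping.lookup t J)"

lemma monomial_eval_superset:
  assumes "finite K" "Poly_Mapping.keys t \<subseteq> K"
  shows "monomial_eval A t = (\<Prod>J\<in>K. det (submatrix A UNIV J) ^ Poly_Mapping.lookup t J)"
  unfolding monomial_eval_def
  by (rule prod.mono_neutral_left) (use assms in \<open>auto simp: in_keys_iff\<close>)

lemma monomial_eval_add: "monomial_eval A (s + t) = monomial_eval A s * monomial_eval A t"
proof -
  let ?K = "Poly_Mapping.keys s \<union> Poly_Mapping.keys t"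
  have "monomial_eval A (s + t) = (\<Prod>J\<in>?K. det (submatrix A UNIV J) ^ Poly_Mapping.lookup (s + t) J)"
    by (rule monomial_eval_superset) (simp_all add: keys_add)
  then show ?thesis
    by (simp add: monomial_eval_superset[of ?K s] monomial_eval_superset[of ?K t] lookup_add power_add prod.distrib)
qed

lemma bracket_eval_superset:
  assumes "finite K" "Poly_Mapping.keys p \<subseteq> K"
  shows "bracket_eval A p = (\<Sum>t\<in>K. Poly_Mapping.lookup p t * monomial_eval A t)"
  unfolding bracket_eval_def monomial_eval_def
  by (rule sum.mono_neutral_left) (use assms in \<open>auto simp: in_keys_iff\<close>)

lemma bracket_eval_single: "bracket_eval A (Poly_Mapping.single t c) = c * monomial_eval A t"
  by (subst bracket_eval_superset[of "{t}"]) auto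

lemma bracket_eval_add: "bracket_eval A (p + q) = bracket_eval A p + bracket_eval A q"
proof -
  let ?K = "Poly_Mapping.keys p \<union> Poly_Mapping.keys q"
  have "bracket_eval A (p + q) = (\<Sum>t\<in>?K. Poly_Mapping.lookup (p + q) t * monomial_eval A t)"
    by (rule bracket_eval_superset) (simp_all add: keys_add)
  then show ?thesis
    by (simp add: bracket_eval_superset[of ?K p] bracket_eval_superset[of ?K q] lookup_add sum.distrib distrib_right)
qed

lemma bracket_eval_0 [simp]: "bracket_eval A 0 = 0"
  by (simp add: bracket_eval_def)

lemma bracket_eval_sum: "bracket_eval A (\<Sum>i\<in>I. f i) = (\<Sum>i\<in>I. bracket_eval A (f i))"
  by (induction I rule: infinite_finite_induct) (simp_all add: bracket_eval_add)

lemma poly_mapping_sum_single: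
  "p = (\<Sum>t\<in>Poly_Mapping.keys p. Poly_Mapping.single t (Poly_Mapping.lookup p t))"
proof (rule poly_mapping_eqI)
  fix k
  show "Poly_Mapping.lookup p k =
    Poly_Mapping.lookup (\<Sum>t\<in>Poly_Mapping.keys p. Poly_Mapping.single t (Poly_Mapping.lookup p t)) k"
    by (cases "k \<in> Poly_Mapping.keys p")
      (auto simp: lookup_sum lookup_single when_def sum.If_cases in_keys_iff)
qed

lemma bracket_eval_mult: "bracket_eval A (p * q) = bracket_eval A p * bracket_eval A q"
proof -
  let ?m = "\<lambda>p t. Poly_Mapping.single t (Poly_Mapping.lookup p t)"
  have "bracket_eval A (p * q) =
      bracket_eval A ((\<Sum>s\<in>Poly_Mapping.keys p. ?m p s) * (\<Sum>t\<in>Poly_Mapping.keys q. ?m q t))"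
    using poly_mapping_sum_single[of p] poly_mapping_sum_single[of q] by simp
  also have "\<dots> = (\<Sum>s\<in>Poly_Mapping.keys p. \<Sum>t\<in>Poly_Mapping.keys q.
      Poly_Mapping.lookup p s * monomial_eval A s * (Poly_Mapping.lookup q t * monomial_eval A t))"
    by (simp add: sum_product bracket_eval_sum mult_single bracket_eval_single monomial_eval_add mult_ac)
  also have "\<dots> = bracket_eval A p * bracket_eval A q"
    by (simp add: bracket_eval_superset[of "Poly_Mapping.keys p" p]
        bracket_eval_superset[of "Poly_Mapping.keys q" q] sum_product)
  finally show ?thesis .
qed

lemma bracket_eval_1 [simp]: "bracket_eval A 1 = 1"
  by (simp add: bracket_eval_single monomial_eval_def flip: single_one)

lemma bracket_eval_uminus: "bracket_eval A (- p) = - bracket_eval A p"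
  using bracket_eval_add[of A p "- p"] by (simp add: eq_neg_iff_add_eq_0 add.commute)

lemma bracket_eval_diff: "bracket_eval A (p - q) = bracket_eval A p - bracket_eval A q"
  using bracket_eval_add[of A p "- q"] by (simp add: bracket_eval_uminus)

lemma bracket_eval_var: "bracket_eval A (bracket_var J) = det (submatrix A UNIV J)"
  by (simp add: bracket_var_def bracket_eval_single monomial_eval_def)

lemma bracket_eval_sign: "bracket_eval A ((- 1) ^ k * p) = (- 1) ^ k * bracket_eval A p"
  by (cases "even k") (simp_all add: bracket_eval_uminus)

lemma inversions_3:
  "inversions [a, b, c] = of_bool (b < a) + of_bool (c < a) + of_bool (c < b)"
proof -
  have "{(i, j). i < j \<and> j < length [a, b, c] \<and> [a, b, c] ! i > [a, b, c] ! j} =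
     (if b < a then {(0, 1)} else {}) \<union> (if c < a then {(0, 2)} else {}) \<union> (if c < b then {(1, 2)} else {})"
    (is "?L = ?R")
  proof (rule Set.set_eqI)
    fix x :: "nat \<times> nat"
    obtain i j where x: "x = (i, j)" by (cases x)
    have "i < j \<and> j < 3 \<longleftrightarrow> (i, j) \<in> {(0, 1), (0, 2), (1, 2)}" by auto
    then have "x \<in> ?L \<longleftrightarrow> (i, j) \<in> {(0, 1), (0, 2), (1, 2)} \<and> [a, b, c] ! i > [a, b, c] ! j"
      unfolding x by auto
    also have "\<dots> \<longleftrightarrow> x \<in> ?R" unfolding x by auto
    finally show "x \<in> ?L \<longleftrightarrow> x \<in> ?R" .
  qed
  then show ?thesis unfolding inversions_def by simp
qed

lemma det_submatrix_sorted:
  assumes A: "A \<in> carrier_mat 3 m" and "a < b" "b < c" "c < m"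
  shows "det (submatrix A UNIV {a, b, c}) = det3 (col A a) (col A b) (col A c)"
proof -
  let ?J = "{a, b, c}" and ?B = "submatrix A UNIV {a, b, c}"
  have cols: "{j. j < dim_col A \<and> j \<in> ?J} = ?J" using assms by auto
  have card: "card ?J = 3" using assms by simp
  have rows: "card {i. i < dim_row A \<and> i \<in> UNIV} = 3" using A by simp
  have B: "?B \<in> carrier_mat 3 3"
    by (rule carrier_matI) (simp_all only: dim_submatrix cols card rows)
  have entry: "?B $$ (i, j) = A $$ (i, pick ?J j)" if "i < 3" "j < 3" for i j
    using submatrix_index[of i A UNIV j ?J] that unfolding cols card rows by (simp add: pick_UNIV)
  have card_singleton: "card {x} = 1" for x :: nat by simp
  have pick: "pick ?J (card {x \<in> ?J. x < y}) = y" if "y \<in> ?J" for y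
    using pick_card_in_set[OF that] .
  have "{x \<in> ?J. x < a} = {}" "{x \<in> ?J. x < b} = {a}" "{x \<in> ?J. x < c} = {a, b}"
    using assms by auto
  moreover have "a \<in> ?J" "b \<in> ?J" "c \<in> ?J" "card {a, b} = 2" using assms by auto
  ultimately have p: "pick ?J 0 = a" "pick ?J 1 = b" "pick ?J 2 = c"
    using pick[of a] pick[of b] pick[of c]
    by (simp_all only: card.empty card_singleton simp_thms)
  have "col ?B j = col A (pick ?J j)" if "j < 3" for j
  proof (rule eq_vecI)
    have "j = 0 \<or> j = 1 \<or> j = 2" using that by auto
    then have "pick ?J j < m" using p assms by (elim disjE) (simp_all del: pick.simps)
    then show "col ?B j $ i = col A (pick ?J j) $ i" if "i < dim_vec (col A (pick ?J j))" for i
      using that \<open>j < 3\<close> A B entry by (simp del: pick.simps)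
  qed (use A B in simp)
  from this[of 0] this[of 1] this[of 2] show ?thesis
    unfolding det_3_cols[OF B] p by simp
qed

text \<open>
  The sign in \<^const>\<open>bracket_seq\<close> turns the minor on the columns in increasing order into
  the determinant of the columns in the given order.
\<close>

lemma bracket_eval_seq_3:
  assumes A: "A \<in> carrier_mat 3 m" and "a < m" "b < m" "c < m"
  shows "bracket_eval A (bracket_seq [a, b, c]) = det3 (col A a) (col A b) (col A c)"
proof (cases "distinct [a, b, c]")
  case True
  note sorted = det_submatrix_sorted[OF A]
  consider "a < b" "b < c" | "a < c" "c < b" | "b < a" "a < c" | "b < c" "c < a"
    | "c < a" "a < b" | "c < b" "b < a" using True by fastforce
  then show ?thesis
  proof cases
    case 1
    then show ?thesis using True assms sorted[of a b c]
      by (simp add: bracket_seq_def inversions_3 bracket_eval_sign bracket_eval_var)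
  next
    case 2
    then have "{a, b, c} = {a, c, b}" "\<not> b < a" by auto
    with 2 show ?thesis using True assms sorted[of a c b] det3_swap(2)[of "col A a" "col A c" "col A b"]
      by (simp add: bracket_seq_def inversions_3 bracket_eval_uminus bracket_eval_var)
  next
    case 3
    then have "{a, b, c} = {b, a, c}" "\<not> c < b" by auto
    with 3 show ?thesis using True assms sorted[of b a c] det3_swap(1)[of "col A b" "col A a" "col A c"]
      by (simp add: bracket_seq_def inversions_3 bracket_eval_uminus bracket_eval_var)
  next
    case 4
    then have "{a, b, c} = {b, c, a}" "b < a" by auto
    moreover have "det3 (col A a) (col A b) (col A c) = det3 (col A b) (col A c) (col A a)"
      by (simp add: det3_def algebra_simps)
    ultimately show ?thesis using 4 True assms sorted[of b c a]
      by (simp add: bracket_seq_def inversions_3 bracket_eval_uminus bracket_eval_var)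
  next
    case 5
    then have "{a, b, c} = {c, a, b}" "c < b" "\<not> b < a" by auto
    moreover have "det3 (col A a) (col A b) (col A c) = det3 (col A c) (col A a) (col A b)"
      by (simp add: det3_def algebra_simps)
    ultimately show ?thesis using 5 True assms sorted[of c a b]
      by (simp add: bracket_seq_def inversions_3 bracket_eval_uminus bracket_eval_var)
  next
    case 6
    then have "{a, b, c} = {c, b, a}" "c < a" by auto
    moreover have "det3 (col A a) (col A b) (col A c) = - det3 (col A c) (col A b) (col A a)"
      by (simp add: det3_def algebra_simps)
    ultimately show ?thesis using 6 True assms sorted[of c b a]
      by (simp add: bracket_seq_def inversions_3 bracket_eval_uminus bracket_eval_var)
  qed
next
  case False
  then show ?thesis by (auto simp: bracket_seq_def)
qed

lemma bracket_eval_plucker_relation: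
  assumes A: "A \<in> carrier_mat 3 m"
    and "set as \<subseteq> {..<m}" "set bs \<subseteq> {..<m}" "length as = 2" "length bs = 4"
  shows "bracket_eval A (plucker_relation as bs) = 0"
proof -
  obtain a b where as: "as = [a, b]"
    using assms(4) by (auto simp: length_Suc_conv numeral_2_eq_2)
  obtain c d e f where bs: "bs = [c, d, e, f]"
    using assms(5) by (auto simp: length_Suc_conv eval_nat_numeral)
  have "plucker_relation as bs = bracket_seq [a, b, c] * bracket_seq [d, e, f]
     - bracket_seq [a, b, d] * bracket_seq [c, e, f] + bracket_seq [a, b, e] * bracket_seq [c, d, f]
     - bracket_seq [a, b, f] * bracket_seq [c, d, e]"
    unfolding plucker_relation_def as bs by (simp add: eval_nat_numeral)
  then show ?thesis
    using assms unfolding as bs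
    by (simp add: bracket_eval_add bracket_eval_diff bracket_eval_mult bracket_eval_seq_3[OF A] det3_plucker)
qed

section \<open>Ideals of the coordinate ring\<close>

lemma bracket_ring_simps [simp]:
  "mult (bracket_ring r m) = (*)" "one (bracket_ring r m) = 1"
  "zero (bracket_ring r m) = 0" "add (bracket_ring r m) = (+)"
  by (simp_all add: bracket_ring_def)

lemma bracket_ring_carrier:
  "p \<in> carrier (bracket_ring r m) \<longleftrightarrow> (\<forall>t\<in>Poly_Mapping.keys p. Poly_Mapping.keys t \<subseteq> r_subsets r m)"
  by (simp add: bracket_ring_def)

lemma keys_uminus: "Poly_Mapping.keys (- p) = Poly_Mapping.keys (p :: 'a \<Rightarrow>\<^sub>0 'b::ab_group_add)"
  by (auto simp: in_keys_iff)

lemma bracket_ring_closed [intro]: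
  shows "0 \<in> carrier (bracket_ring r m)" "1 \<in> carrier (bracket_ring r m)"
    and "p \<in> carrier (bracket_ring r m) \<Longrightarrow> - p \<in> carrier (bracket_ring r m)"
    and "p \<in> carrier (bracket_ring r m) \<Longrightarrow> q \<in> carrier (bracket_ring r m) \<Longrightarrow> p + q \<in> carrier (bracket_ring r m)"
    and "p \<in> carrier (bracket_ring r m) \<Longrightarrow> q \<in> carrier (bracket_ring r m) \<Longrightarrow> p * q \<in> carrier (bracket_ring r m)"
proof -
  show "0 \<in> carrier (bracket_ring r m)" "1 \<in> carrier (bracket_ring r m)"
    by (simp_all add: bracket_ring_carrier)
  show "p \<in> carrier (bracket_ring r m) \<Longrightarrow> - p \<in> carrier (bracket_ring r m)"
    by (simp add: bracket_ring_carrier keys_uminus)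
  assume p: "p \<in> carrier (bracket_ring r m)" "q \<in> carrier (bracket_ring r m)"
  then show "p + q \<in> carrier (bracket_ring r m)"
    using keys_add[of p q] by (auto simp: bracket_ring_carrier)
  show "p * q \<in> carrier (bracket_ring r m)"
    unfolding bracket_ring_carrier
  proof
    fix t assume "t \<in> Poly_Mapping.keys (p * q)"
    then obtain s u where "t = s + u" "s \<in> Poly_Mapping.keys p" "u \<in> Poly_Mapping.keys q"
      using keys_mult[of p q] by auto
    then show "Poly_Mapping.keys t \<subseteq> r_subsets r m"
      using p keys_add[of s u] unfolding bracket_ring_carrier by blast
  qed
qed

lemma bracket_ring_cring: "cring (bracket_ring r m)"
proof (rule cringI)
  show "abelian_group (bracket_ring r m)"
  proof (rule abelian_groupI)
    fix p assume "p \<in> carrier (bracket_ring r m)"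
    then show "\<exists>q\<in>carrier (bracket_ring r m). q \<oplus>\<^bsub>bracket_ring r m\<^esub> p = \<zero>\<^bsub>bracket_ring r m\<^esub>"
      by (intro bexI[of _ "- p"]) auto
  qed (auto simp: add_ac)
  show "comm_monoid (bracket_ring r m)"
    by (rule comm_monoidI) (auto simp: mult_ac)
qed (auto simp: distrib_right)

lemma bracket_seq_closed:
  assumes "set as \<subseteq> {..<m}" "length as = r"
  shows "bracket_seq as \<in> carrier (bracket_ring r m)"
proof -
  have "bracket_var (set as) \<in> carrier (bracket_ring r m)" if "distinct as"
    using assms that by (auto simp: bracket_var_def bracket_ring_carrier r_subsets_def distinct_card)
  moreover have "(- 1) ^ k * p \<in> carrier (bracket_ring r m)" if "p \<in> carrier (bracket_ring r m)" for k p
    using that by (cases "even k") auto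
  ultimately show ?thesis by (auto simp: bracket_seq_def)
qed

lemma plucker_relation_closed:
  assumes "set as \<subseteq> {..<m}" "set bs \<subseteq> {..<m}" "length as + 1 = r" "length bs = r + 1"
  shows "plucker_relation as bs \<in> carrier (bracket_ring r m)"
proof -
  have sum: "(\<Sum>i\<in>I. f i) \<in> carrier (bracket_ring r m)"
    if "\<And>i. i \<in> I \<Longrightarrow> f i \<in> carrier (bracket_ring r m)" for I :: "nat set" and f
    using that by (induction I rule: infinite_finite_induct) auto
  have sign: "(- 1) ^ k \<in> carrier (bracket_ring r m)" for k
    by (cases "even k") auto
  show ?thesis
    unfolding plucker_relation_def
  proof (intro sum bracket_ring_closed(5) sign bracket_seq_closed)
    fix k assume k: "k \<in> {..<length bs}"
    then have "bs ! k \<in> set bs" by simp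
    then show "set (as @ [bs ! k]) \<subseteq> {..<m}" using assms by auto
    show "set (take k bs @ drop (Suc k) bs) \<subseteq> {..<m}"
      using assms by (auto dest: in_set_takeD in_set_dropD)
  qed (use assms in auto)
qed

definition vanishing_polys :: "nat \<Rightarrow> nat \<Rightarrow> complex mat \<Rightarrow> bracket_poly set" where
  "vanishing_polys r m A = {p \<in> carrier (bracket_ring r m). bracket_eval A p = 0}"

lemma vanishing_polys_ideal: "ideal (vanishing_polys r m A) (bracket_ring r m)"
proof -
  have "bracket_eval A \<in> ring_hom (bracket_ring r m) class_ring"
    by (rule ring_hom_memI) (auto simp: bracket_eval_add bracket_eval_mult class_ring_simps)
  then have "ring_hom_ring (bracket_ring r m) (class_ring :: complex ring) (bracket_eval A)"
    using bracket_ring_cring[of r m] class_ring.ring_axioms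
    by (intro ring_hom_ringI2) (auto simp: cring_def)
  from ring_hom_ring.kernel_is_ideal[OF this] show ?thesis
    by (simp add: vanishing_polys_def a_kernel_def' class_ring_simps)
qed

text \<open>
  This is what makes evaluation at a matrix well defined on residue classes.
\<close>

lemma plucker_ideal_vanishes:
  assumes "A \<in> carrier_mat 3 m"
  shows "plucker_ideal 3 m \<subseteq> vanishing_polys 3 m A"
  unfolding plucker_ideal_def
proof (rule ring.genideal_minimal)
  show "ring (bracket_ring 3 m)" using bracket_ring_cring[of 3 m] by (simp add: cring_def)
qed (use assms plucker_relation_closed bracket_eval_plucker_relation vanishing_polys_ideal in \<open>auto simp: vanishing_polys_def\<close>)

lemma plucker_ideal_ideal: "ideal (plucker_ideal r m) (bracket_ring r m)"
  unfolding plucker_ideal_def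
proof (rule ring.genideal_ideal)
  show "ring (bracket_ring r m)" using bracket_ring_cring[of r m] by (simp add: cring_def)
qed (use plucker_relation_closed in auto)

lemma residue_class_closed:
  assumes "p \<in> carrier (bracket_ring r m)"
  shows "residue_class r m p \<in> carrier (coord_ring r m)"
  using assms unfolding residue_class_def coord_ring_def FactRing_def A_RCOSETS_def' by auto

lemma bracket_eval_residue_class:
  assumes "A \<in> carrier_mat 3 m" "q \<in> residue_class 3 m p"
  shows "bracket_eval A q = bracket_eval A p"
  using assms plucker_ideal_vanishes[OF assms(1)]
  by (auto simp: residue_class_def a_r_coset_def' bracket_eval_add vanishing_polys_def)

lemma residue_class_self: "p \<in> carrier (bracket_ring r m) \<Longrightarrow> p \<in> residue_class r m p"
proof -
  assume p: "p \<in> carrier (bracket_ring r m)"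
  interpret ideal "plucker_ideal r m" "bracket_ring r m" by (rule plucker_ideal_ideal)
  show ?thesis unfolding residue_class_def by (rule a_rcos_self[OF p])
qed

text \<open>
  The way to show that an element is not in an ideal of the coordinate ring: a matrix at which all
  generators vanish and the element does not. The residue classes of the polynomials that vanish
  at the matrix form an ideal of the quotient.
\<close>

lemma genideal_coord_ring_vanishes:
  assumes A: "A \<in> carrier_mat 3 m"
    and G: "\<And>g. g \<in> G \<Longrightarrow> \<exists>s\<in>vanishing_polys 3 m A. g = residue_class 3 m s"
    and p: "p \<in> carrier (bracket_ring 3 m)" "residue_class 3 m p \<in> genideal (coord_ring 3 m) G"
  shows "bracket_eval A p = 0"
proof -
  have ring: "ring (bracket_ring 3 m)" using bracket_ring_cring[of 3 m] by (simp add: cring_def)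
  let ?I = "residue_class 3 m ` vanishing_polys 3 m A"
  have "ideal ?I (coord_ring 3 m)"
    using ring.ring_ideal_imp_quot_ideal[OF ring plucker_ideal_ideal vanishing_polys_ideal[of 3 m A]]
    unfolding residue_class_def coord_ring_def by simp
  then have "genideal (coord_ring 3 m) G \<subseteq> ?I"
    unfolding coord_ring_def
    by (intro ring.genideal_minimal ideal.quotient_is_ring plucker_ideal_ideal) (use G in auto)
  with p(2) obtain s where s: "s \<in> vanishing_polys 3 m A" "residue_class 3 m p = residue_class 3 m s" by auto
  then have "p \<in> residue_class 3 m s" using residue_class_self[OF p(1)] by simp
  from bracket_eval_residue_class[OF A this] show ?thesis using s by (simp add: vanishing_polys_def)
qed

text \<open>
  Homogeneous polynomials, with zero homogeneous of every degree.
\<close>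

definition forms :: "nat \<Rightarrow> bracket_poly set" where
  "forms d = {p. \<forall>t\<in>Poly_Mapping.keys p. (\<Sum>J\<in>Poly_Mapping.keys t. Poly_Mapping.lookup t J) = d}"

lemma monomial_degree_add:
  "(\<Sum>J\<in>Poly_Mapping.keys (s + t). Poly_Mapping.lookup (s + t) J)
    = (\<Sum>J\<in>Poly_Mapping.keys s. Poly_Mapping.lookup s J) + (\<Sum>J\<in>Poly_Mapping.keys t. Poly_Mapping.lookup t J)"
  for s t :: "'a \<Rightarrow>\<^sub>0 nat"
proof -
  let ?K = "Poly_Mapping.keys s \<union> Poly_Mapping.keys t"
  have *: "(\<Sum>J\<in>Poly_Mapping.keys u. Poly_Mapping.lookup u J) = (\<Sum>J\<in>?K. Poly_Mapping.lookup u J)"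
    if "Poly_Mapping.keys u \<subseteq> ?K" for u :: "'a \<Rightarrow>\<^sub>0 nat"
    by (rule sum.mono_neutral_left) (use that in \<open>auto simp: in_keys_iff\<close>)
  show ?thesis
    using *[of "s + t"] *[of s] *[of t] by (simp add: keys_add lookup_add sum.distrib)
qed

lemma forms_mult: 
  assumes "p \<in> forms c" "q \<in> forms d"
  shows "p * q \<in> forms (c + d)"
proof -
  have "(\<Sum>J\<in>Poly_Mapping.keys t. Poly_Mapping.lookup t J) = c + d" if t: "t \<in> Poly_Mapping.keys (p * q)" for t
  proof -
    obtain s u where "t = s + u" "s \<in> Poly_Mapping.keys p" "u \<in> Poly_Mapping.keys q"
      using keys_mult[of p q] t by auto
    then show ?thesis using assms by (auto simp: forms_def monomial_degree_add)
  qed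
  then show ?thesis by (simp add: forms_def)
qed

lemma forms_diff: "p \<in> forms d \<Longrightarrow> q \<in> forms d \<Longrightarrow> p - q \<in> forms d"
  using keys_add[of p "- q"] by (auto simp: forms_def keys_uminus)

lemma bracket_seq_form: "bracket_seq as \<in> forms 1"
  by (cases "even (inversions as)") (auto simp: bracket_seq_def forms_def bracket_var_def keys_uminus)

section \<open>Matroid bases and brackets of columns\<close>

lemma lin_dep_iff_det3:
  assumes c: "u \<in> carrier_vec 3" "v \<in> carrier_vec 3" "w \<in> carrier_vec 3" and dist: "distinct [u, v, w]"
  shows "LinearCombinations.module.lin_dep class_ring (cvec 3) {u, v, w} \<longleftrightarrow> det3 u v w = 0"
proof -
  interpret vec_space "TYPE(complex)" 3 .
  let ?U = "mat_of_cols 3 [u, v, w]"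
  have U: "?U \<in> carrier_mat 3 3"
    using mat_of_cols_carrier(1)[of 3 "[u, v, w]"] by (simp add: eval_nat_numeral)
  have cols: "cols ?U = [u, v, w]" by (rule cols_mat_of_cols) (use c in auto)
  have "det3 u v w = 0 \<longleftrightarrow> (\<exists>x. x \<in> carrier_vec 3 \<and> x \<noteq> 0\<^sub>v 3 \<and> ?U *\<^sub>v x = 0\<^sub>v 3)"
    using det_0_iff_vec_prod_zero_field[OF U] det_mat_of_cols_3[OF c] by simp
  also have "\<dots> \<longleftrightarrow> lin_dep (set (cols ?U))"
    using lin_depI[OF U] lin_depE[OF U] dist unfolding cols by blast
  finally show ?thesis unfolding cols by simp
qed

lemma vanishing_on_independent_columns:
  assumes c: "u \<in> carrier_vec 3" "v \<in> carrier_vec 3" "w \<in> carrier_vec 3" "det3 u v w \<noteq> 0"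
    and x: "x \<in> carrier_vec 3" "u \<bullet> x = 0" "v \<bullet> x = 0" "w \<bullet> x = 0"
  shows "x = 0\<^sub>v 3"
proof -
  let ?U = "mat_of_cols 3 [u, v, w]"
  have U: "?U \<in> carrier_mat 3 3"
    using mat_of_cols_carrier(1)[of 3 "[u, v, w]"] by (simp add: eval_nat_numeral)
  have "det (?U\<^sup>T) \<noteq> 0" using det_transpose[OF U] det_mat_of_cols_3[OF c(1-3)] c(4) by simp
  moreover have "?U\<^sup>T *\<^sub>v x = 0\<^sub>v 3"
  proof (rule eq_vecI)
    fix i assume "i < dim_vec (0\<^sub>v 3 :: complex vec)"
    then have "i = 0 \<or> i = 1 \<or> i = 2" by auto
    then show "(?U\<^sup>T *\<^sub>v x) $ i = (0\<^sub>v 3 :: complex vec) $ i"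
      using c x by (elim disjE) (simp_all add: row_transpose numeral_2_eq_2 numeral_3_eq_3)
  qed simp
  ultimately show ?thesis
    using det_0_iff_vec_prod_zero_field[of "?U\<^sup>T" 3] U x(1) by auto
qed

text \<open>
  A nonzero maximal minor forces the rows to be distinct and linearly independent.
\<close>

lemma row_space_represents:
  assumes A: "A \<in> carrier_mat 3 m" and "a < m" "b < m" "c < m"
    and det: "det3 (col A a) (col A b) (col A c) \<noteq> 0"
  shows "represents 3 m A (cspan m (set (rows A)))"
proof -
  interpret vec_space "TYPE(complex)" m .
  let ?x = "span (set (rows A))"
  have rows: "set (rows A) \<subseteq> carrier_vec m" using A by (auto simp: rows_def)
  have sub: "submodule class_ring ?x V" using rows by (intro span_is_submodule) auto
  have own: "set (rows A) \<subseteq> ?x" using rows by (intro in_own_span) auto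
  have dist: "distinct (rows A)"
    unfolding distinct_conv_nth
  proof (intro allI impI)
    fix i j assume ij: "i < length (rows A)" "j < length (rows A)" "i \<noteq> j"
    show "rows A ! i \<noteq> rows A ! j"
    proof
      assume "rows A ! i = rows A ! j"
      then have "row A i = row A j" using ij by simp
      then have eq: "col A k $ i = col A k $ j" if "k < m" for k
        using that ij A by (metis carrier_matD index_col index_row(1) length_rows)
      have "i \<in> {0, 1, 2}" "j \<in> {0, 1, 2}" using ij A by auto
      then have "det3 (col A a) (col A b) (col A c) = 0"
        using \<open>i \<noteq> j\<close> eq[OF \<open>a < m\<close>] eq[OF \<open>b < m\<close>] eq[OF \<open>c < m\<close>]
        unfolding det3_def by (auto simp: algebra_simps)
      with det show False by simp
    qed
  qed
  have indep: "\<not> lin_dep (set (rows A))"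
  proof
    assume "lin_dep (set (rows A))"
    then have "lin_dep (set (cols (A\<^sup>T)))" by (simp add: Matrix.cols_transpose)
    then obtain v where v: "v \<in> carrier_vec 3" "v \<noteq> 0\<^sub>v 3" "A\<^sup>T *\<^sub>v v = 0\<^sub>v m"
      using lin_depE[of "A\<^sup>T" 3] A dist by (metis Matrix.cols_transpose transpose_carrier_mat)
    have "col A k \<bullet> v = 0" if "k < m" for k
    proof -
      have "(A\<^sup>T *\<^sub>v v) $ k = col A k \<bullet> v" using that A by simp
      then show ?thesis using v(3) that by simp
    qed
    with assms v show False
      using vanishing_on_independent_columns[of "col A a" "col A b" "col A c" v] by auto
  qed
  have vs: "vectorspace class_ring (vs ?x)"
    using rows span_is_subspace subspace_is_vs by auto
  show ?thesis
    unfolding represents_def vectorspace.basis_def[OF vs]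
    using A dist indep own span_li_not_depend[OF own sub] by auto
qed

lemma represents_span:
  assumes "VectorSpace.subspace class_ring y (cvec m)" and rep: "represents r m B y"
  shows "cspan m (set (rows B)) = y" "set (rows B) \<subseteq> y"
proof -
  interpret vec_space "TYPE(complex)" m .
  have sub: "submodule class_ring y V" using assms(1) by (simp add: subspace_def)
  have vs: "vectorspace class_ring (vs y)" using assms(1) by (rule subspace_is_vs)
  from rep have *: "module.span class_ring (vs y) (set (rows B)) = y" "set (rows B) \<subseteq> y"
    unfolding represents_def vectorspace.basis_def[OF vs] by auto
  then show "set (rows B) \<subseteq> y" by simp
  show "span (set (rows B)) = y" using * span_li_not_depend(1)[OF *(2) sub] by simp
qed

text \<open>
  If the rows of \<open>A\<close> are combinations of the rows of \<open>B\<close>, one matrix of coefficients maps all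
  columns of \<open>B\<close> to those of \<open>A\<close>.
\<close>

lemma row_space_columns:
  assumes A: "A \<in> carrier_mat 3 m" and B: "B \<in> carrier_mat 3 m"
    and rows: "set (rows A) \<subseteq> cspan m (set (rows B))"
  obtains G where "G \<in> carrier_mat 3 3" "\<And>j. j < m \<Longrightarrow> col A j = G *\<^sub>v col B j"
proof -
  interpret vec_space "TYPE(complex)" m .
  have "\<exists>z\<in>carrier_vec 3. B\<^sup>T *\<^sub>v z = row A i" if "i < 3" for i
  proof -
    have "row A i \<in> set (rows A)" using that A by (metis carrier_matD(1) length_rows nth_mem nth_rows)
    then have "row A i \<in> row_space B" using rows by (auto simp: row_space_def)
    then show ?thesis using row_space_eq[OF B] B by auto
  qed
  then obtain z where z: "\<And>i. i < 3 \<Longrightarrow> z i \<in> carrier_vec 3 \<and> B\<^sup>T *\<^sub>v z i = row A i" by metis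
  define G where "G = mat_of_rows 3 [z 0, z 1, z 2]"
  have G: "G \<in> carrier_mat 3 3" unfolding G_def
    using mat_of_rows_carrier(1)[of 3 "[z 0, z 1, z 2]"] by (simp add: eval_nat_numeral)
  have "col A j = G *\<^sub>v col B j" if j: "j < m" for j
  proof (rule eq_vecI)
    fix i assume "i < dim_vec (G *\<^sub>v col B j)"
    then have i: "i < 3" using G by simp
    then have "i = 0 \<or> i = 1 \<or> i = 2" by auto
    then have "row G i = z i"
      using z unfolding G_def by (elim disjE) (simp_all add: numeral_2_eq_2 numeral_3_eq_3)
    moreover have "col A j $ i = (B\<^sup>T *\<^sub>v z i) $ j" using z[OF i] i j A by simp
    moreover have "(B\<^sup>T *\<^sub>v z i) $ j = col B j \<bullet> z i" using B j by simp
    moreover have "col B j \<bullet> z i = z i \<bullet> col B j"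
      using z[OF i] col_carrier_vec[OF j B] by (intro comm_scalar_prod[of _ 3]) auto
    ultimately show "col A j $ i = (G *\<^sub>v col B j) $ i" using i G by simp
  qed (use A G in simp)
  with G that show ?thesis by blast
qed

text \<open>
  A basis of the matroid is defined through some representing matrix. That every other
  representing matrix gives the same bases follows from \<open>row_space_columns\<close>, since all brackets
  change by the common factor \<open>det G\<close>.
\<close>

lemma matroid_bases_iff_det3:
  assumes y: "VectorSpace.subspace class_ring y (cvec m)" and rep: "represents 3 m B y"
    and m: "a < m" "b < m" "c < m"
  shows "det3 (col B a) (col B b) (col B c) \<noteq> 0 \<longleftrightarrow> distinct [a, b, c] \<and> {a, b, c} \<in> matroid_bases 3 m y"
proof
  have B: "B \<in> carrier_mat 3 m" using rep by (simp add: represents_def)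
  then have cB: "col B j \<in> carrier_vec 3" for j by (metis carrier_matD(1) carrier_vec_dim_vec dim_col)
  {
    assume det: "det3 (col B a) (col B b) (col B c) \<noteq> 0"
    then have dist: "distinct [col B a, col B b, col B c]" by auto
    then have d: "distinct [a, b, c]" and "inj_on (col B) {a, b, c}" by auto
    moreover have "\<not> LinearCombinations.module.lin_dep class_ring (cvec 3) (col B ` {a, b, c})"
      using lin_dep_iff_det3[OF cB cB cB dist] det by simp
    ultimately show "distinct [a, b, c] \<and> {a, b, c} \<in> matroid_bases 3 m y"
      using rep m by (auto simp: matroid_bases_def r_subsets_def)
  }
  {
    assume "distinct [a, b, c] \<and> {a, b, c} \<in> matroid_bases 3 m y"
    then obtain A where dist: "distinct [a, b, c]" and A: "represents 3 m A y" "inj_on (col A) {a, b, c}"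
      "\<not> LinearCombinations.module.lin_dep class_ring (cvec 3) (col A ` {a, b, c})"
      by (auto simp: matroid_bases_def)
    then have cA: "A \<in> carrier_mat 3 m" by (simp add: represents_def)
    then have c: "col A j \<in> carrier_vec 3" for j by (metis carrier_matD(1) carrier_vec_dim_vec dim_col)
    have "distinct [col A a, col A b, col A c]" using A(2) dist by (auto simp: inj_on_def)
    then have "det3 (col A a) (col A b) (col A c) \<noteq> 0"
      using lin_dep_iff_det3[OF c c c, of a b c] A(3) by simp
    moreover obtain G where "G \<in> carrier_mat 3 3" "\<And>j. j < m \<Longrightarrow> col A j = G *\<^sub>v col B j"
      using row_space_columns[OF cA B] represents_span[OF y A(1)] represents_span[OF y rep] by metis
    ultimately show "det3 (col B a) (col B b) (col B c) \<noteq> 0"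
      using m det3_mult_mat[OF _ cB cB cB] by auto
  }
qed

section \<open>The conic quartics in the coordinate ring\<close>

definition conic_quartic_poly :: "nat \<Rightarrow> nat \<Rightarrow> nat \<Rightarrow> nat \<Rightarrow> nat \<Rightarrow> nat \<Rightarrow> bracket_poly" where
  "conic_quartic_poly a b c d e f =
     bracket_seq [a, b, c] * bracket_seq [a, d, e] * bracket_seq [b, d, f] * bracket_seq [c, e, f]
     - bracket_seq [a, b, d] * bracket_seq [a, c, e] * bracket_seq [b, c, f] * bracket_seq [d, e, f]"

lemma bracket_ring_diff: "p \<in> carrier (bracket_ring r m) \<Longrightarrow> q \<in> carrier (bracket_ring r m) \<Longrightarrow> p - q \<in> carrier (bracket_ring r m)"
  using bracket_ring_closed(3,4)[where p = q and r = r and m = m] bracket_ring_closed(4)[of p r m "- q"] by auto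

lemma conic_quartic_poly_closed:
  assumes "a < m" "b < m" "c < m" "d < m" "e < m" "f < m"
  shows "conic_quartic_poly a b c d e f \<in> carrier (bracket_ring 3 m)"
  unfolding conic_quartic_poly_def
  by (intro bracket_ring_diff bracket_ring_closed(5) bracket_seq_closed) (use assms in auto)

lemma conic_quartic_poly_form: "conic_quartic_poly a b c d e f \<in> forms 4"
proof -
  have four: "p * q * r * s \<in> forms 4" if "p \<in> forms 1" "q \<in> forms 1" "r \<in> forms 1" "s \<in> forms 1" for p q r s
    using forms_mult[OF forms_mult[OF forms_mult[OF that(1,2)] that(3)] that(4)] by (simp add: numeral_eq_Suc)
  then show ?thesis
    unfolding conic_quartic_poly_def by (intro forms_diff four bracket_seq_form)
qed

lemma bracket_eval_conic_quartic_poly: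
  assumes "A \<in> carrier_mat 3 m" "a < m" "b < m" "c < m" "d < m" "e < m" "f < m"
  shows "bracket_eval A (conic_quartic_poly a b c d e f) =
    conic_quartic (col A a) (col A b) (col A c) (col A d) (col A e) (col A f)"
  using assms unfolding conic_quartic_poly_def conic_quartic_def
  by (simp add: bracket_eval_diff bracket_eval_mult bracket_eval_seq_3[OF assms(1)])

lemma det_submatrix_3:
  assumes "A \<in> carrier_mat 3 m" "a < m" "b < m" "c < m" "distinct [a, b, c]"
  shows "det (submatrix A UNIV {a, b, c}) = 0 \<longleftrightarrow> det3 (col A a) (col A b) (col A c) = 0"
  using bracket_eval_seq_3[OF assms(1-4)] assms(5)
  by (auto simp: bracket_seq_def bracket_eval_sign bracket_eval_var)

text \<open>
  The columns of a test matrix: the columns at positions \<open>p 1, ..., p 5, p i\<close> are six points that do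
  not lie on a conic, all others vanish. The first, second and fourth of them are collinear, so
  that the second term of the quartic vanishes; the first one has the value 1.
\<close>

definition six_points :: "(nat \<Rightarrow> nat) \<Rightarrow> nat \<Rightarrow> nat \<Rightarrow> complex vec" where
  "six_points p i j =
    (if j = p 1 then vec_of_list [1, 0, 0] else if j = p 2 then vec_of_list [0, 1, 0]
     else if j = p 3 then vec_of_list [0, 0, 1] else if j = p 4 then vec_of_list [1, 1, 0]
     else if j = p 5 then vec_of_list [0, 1, 1] else if j = p i then vec_of_list [1, 0, 1]
     else 0\<^sub>v 3)"

definition six_point_matrix :: "nat \<Rightarrow> (nat \<Rightarrow> nat) \<Rightarrow> nat \<Rightarrow> complex mat" where
  "six_point_matrix m p i = mat 3 m (\<lambda>(k, j). six_points p i j $ k)"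

lemma six_point_matrix_carrier: "six_point_matrix m p i \<in> carrier_mat 3 m"
  by (simp add: six_point_matrix_def)

lemma col_six_point_matrix: "j < m \<Longrightarrow> col (six_point_matrix m p i) j = six_points p i j"
  by (rule eq_vecI) (auto simp: six_point_matrix_def six_points_def)

lemma conic_quartic_six_points:
  assumes p: "inj_on p {1..n}" "p ` {1..n} \<subseteq> {..<m}" and i: "i \<in> {6..n}" and k: "k \<in> {6..n}"
  shows "bracket_eval (six_point_matrix m p i) (conic_quartic_poly (p 1) (p 2) (p 3) (p 4) (p 5) (p k))
    = of_bool (k = i)"
proof -
  have less: "p j < m" if "j \<in> {1..n}" for j using subsetD[OF p(2) imageI[OF that]] by simp
  have [simp]: "p j = p l \<longleftrightarrow> j = l" if "j \<in> {1..n}" "l \<in> {1..n}" for j l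
    using p(1) that by (auto simp: inj_on_eq_iff)
  show ?thesis
    using i k
    by (subst bracket_eval_conic_quartic_poly[OF six_point_matrix_carrier])
      (auto simp: less col_six_point_matrix six_points_def conic_quartic_def det3_def numeral_2_eq_2)
qed

text \<open>
  Three columns of general points always form a basis, so every non-basis contains a column that is
  zero in the test matrix.
\<close>

lemma nonbasis_ideal_vanishes_at_six_points:
  assumes x: "VectorSpace.subspace class_ring x (cvec m)" and rep: "represents 3 m A x"
    and p: "inj_on p {1..n}" "p ` {1..n} \<subseteq> {..<m}" and i: "i \<in> {6..n}"
    and gen: "\<And>j k l. {j, k, l} \<subseteq> {1..n} \<Longrightarrow> distinct [j, k, l] \<Longrightarrow> det3 (col A (p j)) (col A (p k)) (col A (p l)) \<noteq> 0"
    and q: "q \<in> carrier (bracket_ring 3 m)" "residue_class 3 m q \<in> nonbasis_ideal 3 m x"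
  shows "bracket_eval (six_point_matrix m p i) q = 0"
proof (rule genideal_coord_ring_vanishes[OF six_point_matrix_carrier _ q(1)])
  show "residue_class 3 m q \<in> genideal (coord_ring 3 m) (bracket 3 m ` (r_subsets 3 m - matroid_bases 3 m x))"
    using q(2) by (simp add: nonbasis_ideal_def)
  fix g assume "g \<in> bracket 3 m ` (r_subsets 3 m - matroid_bases 3 m x)"
  then obtain J where J: "J \<in> r_subsets 3 m" "J \<notin> matroid_bases 3 m x" and g: "g = bracket 3 m J" by auto
  then obtain a b c where abc: "J = {a, b, c}" "distinct [a, b, c]" "a < m" "b < m" "c < m"
    by (auto simp: r_subsets_def card_3_iff)
  have "\<exists>y\<in>{a, b, c}. y \<notin> p ` {1..n}"
  proof (rule ccontr)
    assume "\<not> ?thesis"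
    then obtain j k l where jkl: "a = p j" "b = p k" "c = p l" "{j, k, l} \<subseteq> {1..n}" by auto
    then have "distinct [j, k, l]" using abc by auto
    with gen jkl J abc show False
      using matroid_bases_iff_det3[OF x rep, of a b c] by auto
  qed
  moreover have "six_points p i y = 0\<^sub>v 3" if "y \<notin> p ` {1..n}" for y
    using that i by (auto simp: six_points_def)
  ultimately have "\<exists>y\<in>{a, b, c}. col (six_point_matrix m p i) y = 0\<^sub>v 3"
    using abc col_six_point_matrix by auto
  then have "det3 (col (six_point_matrix m p i) a) (col (six_point_matrix m p i) b) (col (six_point_matrix m p i) c) = 0"
    by (auto simp: det3_def)
  then have "bracket_eval (six_point_matrix m p i) (bracket_var J) = 0"
    using det_submatrix_3[OF six_point_matrix_carrier[of m p i] abc(3-5,2)] abc(1) by (simp add: bracket_eval_var)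
  moreover have "bracket_var J \<in> carrier (bracket_ring 3 m)"
    using J by (simp add: bracket_var_def bracket_ring_carrier)
  ultimately show "\<exists>s\<in>vanishing_polys 3 m (six_point_matrix m p i). g = residue_class 3 m s"
    using g by (auto simp: vanishing_polys_def bracket_def)
qed

text \<open>
  Columns \<open>p, q, r\<close> are the Pascal points of the hexagon \<open>abcdef\<close>. All conditions are of the
  form that a bracket vanishes or not, whence they hold for one point of a matroid stratum if and
  only if they hold for all of them. The nonzero brackets are those of \<open>pascal_iff_conic\<close>.
\<close>

definition pascal_config :: "complex mat \<Rightarrow> nat \<Rightarrow> nat \<Rightarrow> nat \<Rightarrow> nat \<Rightarrow> nat \<Rightarrow> nat \<Rightarrow> nat \<Rightarrow> nat \<Rightarrow> nat \<Rightarrow> bool" where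
  "pascal_config A a b c d e f p q r \<longleftrightarrow> 
    (let D = (\<lambda>i j k. det3 (col A i) (col A j) (col A k)) in
     D a b p = 0 \<and> D d e p = 0 \<and> D a d e \<noteq> 0 \<and> D a b e \<noteq> 0 \<and> D a p e \<noteq> 0 \<and>
     D b c q = 0 \<and> D e f q = 0 \<and> D b e f \<noteq> 0 \<and> D b c f \<noteq> 0 \<and> D b q f \<noteq> 0 \<and>
     D c d r = 0 \<and> D f a r = 0 \<and> D c f a \<noteq> 0 \<and> D c d a \<noteq> 0 \<and> D c r a \<noteq> 0)"

lemma pascal_config_iff:
  assumes A: "A \<in> carrier_mat 3 m" and m: "a < m" "b < m" "c < m" "d < m" "e < m" "f < m" "p < m" "q < m" "r < m"
    and cfg: "pascal_config A a b c d e f p q r"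
  shows "det3 (col A p) (col A q) (col A r) = 0 \<longleftrightarrow>
    conic_quartic (col A a) (col A b) (col A c) (col A d) (col A e) (col A f) = 0"
proof -
  have c: "col A j \<in> carrier_vec 3" if "j < m" for j using col_carrier_vec[OF that A] .
  show ?thesis
    by (rule pascal_iff_conic) (use cfg c m in \<open>auto simp: pascal_config_def Let_def\<close>)
qed

lemma stratum_det3_iff:
  assumes x: "VectorSpace.subspace class_ring x (cvec m)" "represents 3 m A x"
    and y: "y \<in> matroid_stratum 3 m x" "represents 3 m B y"
    and m: "a < m" "b < m" "c < m"
  shows "det3 (col B a) (col B b) (col B c) = 0 \<longleftrightarrow> det3 (col A a) (col A b) (col A c) = 0"
proof -
  have "VectorSpace.subspace class_ring y (cvec m)" "matroid_bases 3 m y = matroid_bases 3 m x"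
    using y(1) by (auto simp: matroid_stratum_def Gr_def)
  then show ?thesis
    using matroid_bases_iff_det3[OF x m] matroid_bases_iff_det3[OF _ y(2) m] by metis
qed

text \<open>
  Collinearity of the three Pascal points is the bridge: it follows from the conic at the point \<open>x\<close>,
  carries over to the whole stratum because it is a matroid condition, and there implies that the
  quartic vanishes. The zero locus of the quartic is closed, so it contains the matroid variety as
  well.
\<close>

lemma conic_quartic_in_matroid_ideal:
  assumes x: "VectorSpace.subspace class_ring x (cvec m)" "represents 3 m A x"
    and m: "a < m" "b < m" "c < m" "d < m" "e < m" "f < m" "p < m" "q < m" "r < m"
    and cfg: "pascal_config A a b c d e f p q r"
    and conic: "conic_quartic (col A a) (col A b) (col A c) (col A d) (col A e) (col A f) = 0"
  defines "F \<equiv> residue_class 3 m (conic_quartic_poly a b c d e f)"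
  shows "F \<in> matroid_ideal 3 m x" "homogeneous 3 m 4 F"
proof -
  have A: "A \<in> carrier_mat 3 m" using x(2) by (simp add: represents_def)
  show hom: "homogeneous 3 m 4 F"
    using conic_quartic_poly_closed[OF m(1-6)] conic_quartic_poly_form[of a b c d e f]
    unfolding homogeneous_def F_def forms_def by auto
  let ?Z = "{y \<in> Gr 3 m. \<forall>f\<in>{F}. vanishes_at 3 m f y}"
  have "zariski_closed 3 m ?Z" using hom unfolding zariski_closed_def by (intro exI[of _ "{F}"]) auto
  moreover have "matroid_stratum 3 m x \<subseteq> ?Z"
  proof
    fix y assume y: "y \<in> matroid_stratum 3 m x"
    have "bracket_eval B g = 0" if B: "represents 3 m B y" and g: "g \<in> F" for B g
    proof -
      have cB: "B \<in> carrier_mat 3 m" using B by (simp add: represents_def)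
      note iff = stratum_det3_iff[OF x y B]
      have "pascal_config B a b c d e f p q r"
        using cfg m unfolding pascal_config_def Let_def by (simp add: iff)
      moreover have "det3 (col B p) (col B q) (col B r) = 0"
        using pascal_config_iff[OF A m cfg] conic m by (simp add: iff)
      ultimately have "conic_quartic (col B a) (col B b) (col B c) (col B d) (col B e) (col B f) = 0"
        using pascal_config_iff[OF cB m] by simp
      then show ?thesis
        using bracket_eval_residue_class[OF cB g[unfolded F_def]] bracket_eval_conic_quartic_poly[OF cB m(1-6)] by simp
    qed
    then show "y \<in> ?Z" using y by (auto simp: vanishes_at_def matroid_stratum_def)
  qed
  ultimately have "matroid_variety 3 m x \<subseteq> ?Z"
    unfolding matroid_variety_def by (intro hull_minimal)
  then show "F \<in> matroid_ideal 3 m x"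
    unfolding matroid_ideal_def F_def using residue_class_closed[OF conic_quartic_poly_closed[OF m(1-6)]] by auto
qed

text \<open>
  The quartics for \<open>i = 6, ..., n\<close> are separated by the test matrices: the \<open>i\<close>-th one kills all
  quartics except the \<open>i\<close>-th, since the last point of every other quartic is a zero column.
\<close>

lemma independent_conic_quartics:
  fixes p :: "nat \<Rightarrow> nat"
  assumes "n > 6" and x: "VectorSpace.subspace class_ring x (cvec m)" and rep: "represents 3 m A x"
    and p: "inj_on p {1..n}" "p ` {1..n} \<subseteq> {..<m}"
    and gen: "\<And>j k l. {j, k, l} \<subseteq> {1..n} \<Longrightarrow> distinct [j, k, l] \<Longrightarrow> det3 (col A (p j)) (col A (p k)) (col A (p l)) \<noteq> 0"
    and conic: "\<And>i. i \<in> {6..n} \<Longrightarrow> conic_quartic (col A (p 1)) (col A (p 2)) (col A (p 3)) (col A (p 4)) (col A (p 5)) (col A (p i)) = 0"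
    and cfg: "\<And>i. i \<in> {6..n} \<Longrightarrow> \<exists>q\<in>{..<m}. \<exists>r\<in>{..<m}. \<exists>s\<in>{..<m}. 
      pascal_config A (p 1) (p 2) (p 3) (p 4) (p 5) (p i) q r s"
  shows "\<exists>S \<subseteq> matroid_ideal 3 m x. card S \<ge> 2 \<and> independent_elements 3 m S \<and>
    (\<forall>f\<in>S. homogeneous 3 m 4 f \<and> f \<notin> nonbasis_ideal 3 m x)"
proof -
  define g where "g = (\<lambda>i. conic_quartic_poly (p 1) (p 2) (p 3) (p 4) (p 5) (p i))"
  define F where "F = (\<lambda>i. residue_class 3 m (g i))"
  let ?W = "six_point_matrix m p"
  have pm: "p j < m" if "j \<in> {1..n}" for j using subsetD[OF p(2) imageI[OF that]] by simp
  have six: "p 1 < m" "p 2 < m" "p 3 < m" "p 4 < m" "p 5 < m" using pm \<open>n > 6\<close> by auto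
  have pi: "p i < m" if "i \<in> {6..n}" for i using pm that by auto
  have g: "g i \<in> carrier (bracket_ring 3 m)" if "i \<in> {6..n}" for i
    unfolding g_def by (intro conic_quartic_poly_closed six pi that)
  have eval: "bracket_eval (?W i) (g k) = of_bool (k = i)" if "i \<in> {6..n}" "k \<in> {6..n}" for i k
    unfolding g_def by (rule conic_quartic_six_points[OF p that])
  have mem: "F i \<in> matroid_ideal 3 m x" "homogeneous 3 m 4 (F i)" if i: "i \<in> {6..n}" for i
  proof -
    obtain q r s where "q < m" "r < m" "s < m" and c: "pascal_config A (p 1) (p 2) (p 3) (p 4) (p 5) (p i) q r s"
      using cfg[OF i] by auto
    then show "F i \<in> matroid_ideal 3 m x" "homogeneous 3 m 4 (F i)"
      unfolding F_def g_def
      using conic_quartic_in_matroid_ideal[OF x rep six pi[OF i] _ _ _ c conic[OF i]] by auto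
  qed
  have not_in: "F i \<notin> nonbasis_ideal 3 m x" if i: "i \<in> {6..n}" for i
    using nonbasis_ideal_vanishes_at_six_points[OF x rep p i gen g[OF i]] eval[OF i i] unfolding F_def by auto
  have indep: "F i \<notin> genideal (coord_ring 3 m) (F ` {6..n} - {F i})" if i: "i \<in> {6..n}" for i
  proof
    assume F: "F i \<in> genideal (coord_ring 3 m) (F ` {6..n} - {F i})"
    have "bracket_eval (?W i) (g i) = 0"
    proof (rule genideal_coord_ring_vanishes[OF six_point_matrix_carrier _ g[OF i] F[unfolded F_def[THEN fun_cong, of i]]])
      fix f assume "f \<in> F ` {6..n} - {residue_class 3 m (g i)}"
      then have "f \<in> F ` {6..n} - {F i}" by (simp add: F_def)
      then obtain k where k: "k \<in> {6..n}" "k \<noteq> i" "f = F k" by blast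
      then show "\<exists>s\<in>vanishing_polys 3 m (?W i). f = residue_class 3 m s"
        using g eval[OF i k(1)] by (auto simp: F_def vanishing_polys_def)
    qed
    with eval[OF i i] show False by simp
  qed
  have "inj_on F {6..n}"
  proof (rule inj_onI)
    fix i k assume i: "i \<in> {6..n}" and k: "k \<in> {6..n}" and "F i = F k"
    then have "g i \<in> residue_class 3 m (g k)" using residue_class_self[OF g[OF i]] by (simp add: F_def)
    from bracket_eval_residue_class[OF six_point_matrix_carrier[of m p i] this] show "i = k"
      using eval[OF i i] eval[OF i k] by (auto split: if_splits)
  qed
  then have "card (F ` {6..n}) \<ge> 2" using \<open>n > 6\<close> by (simp add: card_image)
  moreover have "independent_elements 3 m (F ` {6..n})"
    using indep unfolding independent_elements_def by auto
  ultimately show ?thesis using mem not_in by (intro exI[of _ "F ` {6..n}"]) auto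
qed

section \<open>Points and lines of the projective plane\<close>

lemma det3_zero_on_span:
  assumes u: "u \<in> carrier_vec 3" "v \<in> carrier_vec 3" and S: "S \<subseteq> carrier_vec 3"
    and zero: "\<And>s. s \<in> S \<Longrightarrow> det3 u v s = 0" and w: "w \<in> cspan 3 S"
  shows "w \<in> carrier_vec 3" "det3 u v w = 0"
proof -
  interpret vec_space "TYPE(complex)" 3 .
  let ?N = "{w \<in> carrier_vec 3. det3 u v w = 0}"
  have "det3 u v (x + y) = det3 u v x + det3 u v y" if "x \<in> carrier_vec 3" "y \<in> carrier_vec 3" for x y
    using that by (simp add: det3_def algebra_simps)
  moreover have "det3 u v (0\<^sub>v 3) = 0" by (simp add: det3_def)
  ultimately have "submodule class_ring ?N V"
    by (intro submodule.intro) (auto simp: module_axioms det3_linear)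
  then have "span S \<subseteq> ?N" by (rule span_is_subset[rotated]) (use S zero in auto)
  with w show "w \<in> carrier_vec 3" "det3 u v w = 0" by auto
qed

lemma smult_in_cspan: "u \<in> carrier_vec 3 \<Longrightarrow> c \<cdot>\<^sub>v u \<in> cspan 3 {u}"
proof -
  interpret vec_space "TYPE(complex)" 3 .
  assume "u \<in> carrier_vec 3"
  then show ?thesis by (intro smult_in_span) (auto intro: in_own_span[THEN subsetD])
qed

lemma cspan_singleton_subset: "u \<in> carrier_vec 3 \<Longrightarrow> v \<in> cspan 3 {u} \<Longrightarrow> cspan 3 {v} \<subseteq> cspan 3 {u}"
proof -
  interpret vec_space "TYPE(complex)" 3 .
  assume "u \<in> carrier_vec 3" "v \<in> cspan 3 {u}"
  then show ?thesis by (intro span_is_subset span_is_submodule) auto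
qed

lemma self_in_cspan: "u \<in> carrier_vec 3 \<Longrightarrow> u \<in> cspan 3 {u}"
  using smult_in_cspan[of u 1] by simp

lemma cspan_singleton_in_plane:
  assumes u: "u \<in> carrier_vec 3"
  shows "cspan 3 {u} \<in> proj_plane \<longleftrightarrow> u \<noteq> 0\<^sub>v 3"
proof -
  interpret vec_space "TYPE(complex)" 3 .
  have sub: "subspace class_ring (span {u}) V" using u by (intro span_is_subspace) auto
  have "u = 0\<^sub>v 3 \<Longrightarrow> span {u} = span {}" using span_zero span_empty by simp
  moreover have "vectorspace.dim class_ring (vs (span {u})) = 1" if "u \<noteq> 0\<^sub>v 3"
  proof -
    have "\<not> lin_dep {u}" using lindep_span[of "{u}"] u that span_empty by auto
    moreover have "u \<in> span {u}" using self_in_cspan[OF u] .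
    ultimately have "vectorspace.basis class_ring (vs (span {u})) {u}"
      unfolding vectorspace.basis_def[OF subspace_is_vs[OF sub]]
      using span_li_not_depend[of "{u}" "span {u}"] sub by (auto simp: subspace_def)
    from vectorspace.dim_basis[OF subspace_is_vs[OF sub] _ this] show ?thesis by simp
  qed
  ultimately show ?thesis
    using sub dim_zero_vs unfolding Gr_def by auto
qed

text \<open>
  If all brackets \<open>[u v y]\<close> vanish, so do the minors of size two of \<open>u\<close> and \<open>v\<close>, and the two
  vectors are proportional.
\<close>

lemma distinct_points_independent:
  assumes c: "u \<in> carrier_vec 3" "v \<in> carrier_vec 3" and nz: "u \<noteq> 0\<^sub>v 3" "v \<noteq> 0\<^sub>v 3"
    and ne: "cspan 3 {u} \<noteq> cspan 3 {v}"
  shows "\<exists>y\<in>carrier_vec 3. det3 u v y \<noteq> 0"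
proof (rule ccontr)
  assume "\<not> ?thesis"
  then have D: "det3 u v y = 0" if "y \<in> carrier_vec 3" for y using that by blast
  obtain k where k: "k < 3" "u $ k \<noteq> 0" using c nz by (metis carrier_vecD eq_vecI index_zero_vec)
  have cross: "u $ k * v $ i = v $ k * u $ i" if "i < 3" for i
  proof -
    have "det3 u v (unit_vec 3 j) = 0" for j by (rule D) simp
    from this[of 0] this[of 1] this[of 2] have "u $ 1 * v $ 2 = u $ 2 * v $ 1" "u $ 0 * v $ 2 = u $ 2 * v $ 0"
      "u $ 0 * v $ 1 = u $ 1 * v $ 0" by (simp_all add: det3_def algebra_simps)
    moreover have "k = 0 \<or> k = 1 \<or> k = 2" "i = 0 \<or> i = 1 \<or> i = 2" using k that by auto
    ultimately show ?thesis by (elim disjE) (simp_all only: mult.commute)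
  qed
  then have v: "v = (v $ k / u $ k) \<cdot>\<^sub>v u"
    using c k by (intro eq_vecI) (auto simp: field_simps)
  have "v $ k \<noteq> 0"
  proof
    assume "v $ k = 0"
    then have "v = 0 \<cdot>\<^sub>v u" using v by simp
    then show False using nz c by (auto intro!: eq_vecI)
  qed
  then have u: "u = (u $ k / v $ k) \<cdot>\<^sub>v v"
    using c k cross by (intro eq_vecI) (auto simp: field_simps)
  have "cspan 3 {v} \<subseteq> cspan 3 {u}" using cspan_singleton_subset[OF c(1)] smult_in_cspan[OF c(1)] v by metis
  moreover have "cspan 3 {u} \<subseteq> cspan 3 {v}" using cspan_singleton_subset[OF c(2)] smult_in_cspan[OF c(2)] u by metis
  ultimately show False using ne by auto
qed

lemma proj_line_det3:
  assumes c: "u \<in> carrier_vec 3" "v \<in> carrier_vec 3" "q \<in> carrier_vec 3"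
    and q: "cspan 3 {q} \<in> proj_line (cspan 3 {u}) (cspan 3 {v})"
  shows "det3 u v q = 0"
proof (rule det3_zero_on_span(2)[OF c(1,2)])
  have on: "w \<in> carrier_vec 3 \<and> det3 u v w = 0" if "w \<in> cspan 3 {u} \<union> cspan 3 {v}" for w
    using that det3_zero_on_span[OF c(1,2), of "{u}" w] det3_zero_on_span[OF c(1,2), of "{v}" w] c by auto
  then show "cspan 3 {u} \<union> cspan 3 {v} \<subseteq> carrier_vec 3" by auto
  show "det3 u v s = 0" if "s \<in> cspan 3 {u} \<union> cspan 3 {v}" for s using on that by auto
  show "q \<in> cspan 3 (cspan 3 {u} \<union> cspan 3 {v})"
    using q self_in_cspan[OF c(3)] by (auto simp: proj_line_def)
qed

lemma combination_in_proj_line: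
  assumes c: "u \<in> carrier_vec 3" "v \<in> carrier_vec 3" and t: "\<alpha> \<cdot>\<^sub>v u + \<beta> \<cdot>\<^sub>v v \<noteq> 0\<^sub>v 3"
  shows "cspan 3 {\<alpha> \<cdot>\<^sub>v u + \<beta> \<cdot>\<^sub>v v} \<in> proj_line (cspan 3 {u}) (cspan 3 {v})"
proof -
  interpret vec_space "TYPE(complex)" 3 .
  let ?S = "span {u} \<union> span {v}"
  have S: "?S \<subseteq> carrier_vec 3"
    using c by (intro Un_least order_trans[OF span_is_subset2]) auto
  then have sub: "submodule class_ring (span ?S) V" by (intro span_is_submodule) auto
  have own: "?S \<subseteq> span ?S" using S by (intro in_own_span) auto
  have "\<alpha> \<cdot>\<^sub>v u \<in> span ?S" "\<beta> \<cdot>\<^sub>v v \<in> span ?S"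
    by (rule subsetD[OF own UnI1[OF smult_in_cspan[OF c(1)]]],
        rule subsetD[OF own UnI2[OF smult_in_cspan[OF c(2)]]])
  then have "\<alpha> \<cdot>\<^sub>v u + \<beta> \<cdot>\<^sub>v v \<in> span ?S" using submodule.m_closed[OF sub] by simp
  then have "span {\<alpha> \<cdot>\<^sub>v u + \<beta> \<cdot>\<^sub>v v} \<subseteq> span ?S" by (intro span_is_subset sub) auto
  then show ?thesis
    using cspan_singleton_in_plane[of "\<alpha> \<cdot>\<^sub>v u + \<beta> \<cdot>\<^sub>v v"] c t unfolding proj_line_def by simp
qed

text \<open>
  The vector \<^const>\<open>line_meet\<close> is defined as a combination of \<open>c\<close> and \<open>d\<close>; expanding the double
  cross product the other way exhibits it as a combination of \<open>a\<close> and \<open>b\<close>.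
\<close>

lemma line_meet_on_lines:
  assumes c: "a \<in> carrier_vec 3" "b \<in> carrier_vec 3" "c \<in> carrier_vec 3" "d \<in> carrier_vec 3"
    and nz: "det3 a b d \<noteq> 0" "det3 a c d \<noteq> 0"
  shows "cspan 3 {line_meet a b c d} \<in>
    proj_line (cspan 3 {a}) (cspan 3 {b}) \<inter> proj_line (cspan 3 {c}) (cspan 3 {d})"
proof
  have "det3 a (line_meet a b c d) d = det3 a b d * det3 a c d"
    using c by (simp add: line_meet_def det3_linear)
  then have ne: "line_meet a b c d \<noteq> 0\<^sub>v 3" using nz by (auto simp: det3_def)
  have 1: "line_meet a b c d = det3 a b d \<cdot>\<^sub>v c + (- det3 a b c) \<cdot>\<^sub>v d"
    using c by (intro eq_vecI) (auto simp: line_meet_def)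
  show "cspan 3 {line_meet a b c d} \<in> proj_line (cspan 3 {c}) (cspan 3 {d})"
    unfolding 1 by (rule combination_in_proj_line[OF c(3,4) ne[unfolded 1]])
  have 2: "line_meet a b c d = (- det3 b c d) \<cdot>\<^sub>v a + det3 a c d \<cdot>\<^sub>v b"
  proof (rule eq_vecI)
    fix i assume "i < dim_vec ((- det3 b c d) \<cdot>\<^sub>v a + det3 a c d \<cdot>\<^sub>v b)"
    then have i: "i < 3" using c by simp
    then have "i = 0 \<or> i = 1 \<or> i = 2" by auto
    then have "det3 a b d * c $ i - det3 a b c * d $ i = det3 a c d * b $ i - det3 b c d * a $ i"
      by (elim disjE) (simp_all add: det3_def algebra_simps)
    then show "line_meet a b c d $ i = ((- det3 b c d) \<cdot>\<^sub>v a + det3 a c d \<cdot>\<^sub>v b) $ i"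
      using c i by (simp add: line_meet_def)
  qed (use c in \<open>simp add: line_meet_def\<close>)
  show "cspan 3 {line_meet a b c d} \<in> proj_line (cspan 3 {a}) (cspan 3 {b})"
    unfolding 2 by (rule combination_in_proj_line[OF c(1,2) ne[unfolded 2]])
qed

text \<open>
  Any column that spans an intersection point will do: it is a nonzero vector on both lines. If
  the last bracket vanished, \<open>line_meet_unique\<close> would make this column zero.
\<close>

lemma intersection_column:
  assumes A: "A \<in> carrier_mat 3 m" and m: "a < m" "b < m" "c < m" "d < m"
    and nz: "det3 (col A a) (col A b) (col A d) \<noteq> 0" "det3 (col A a) (col A c) (col A d) \<noteq> 0"
    and cols: "proj_line (cspan 3 {col A a}) (cspan 3 {col A b}) \<inter> proj_line (cspan 3 {col A c}) (cspan 3 {col A d})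
      \<subseteq> (\<lambda>j. cspan 3 {col A j}) ` {..<m}"
  shows "\<exists>q\<in>{..<m}. det3 (col A a) (col A b) (col A q) = 0 \<and> det3 (col A c) (col A d) (col A q) = 0 \<and>
    det3 (col A a) (col A q) (col A d) \<noteq> 0"
proof -
  have cA: "col A j \<in> carrier_vec 3" if "j < m" for j using col_carrier_vec[OF that A] .
  note c = cA[OF m(1)] cA[OF m(2)] cA[OF m(3)] cA[OF m(4)]
  let ?t = "line_meet (col A a) (col A b) (col A c) (col A d)"
  obtain q where q: "q < m" "cspan 3 {?t} = cspan 3 {col A q}"
    using line_meet_on_lines[OF c nz] cols by blast
  then have on: "cspan 3 {col A q} \<in> proj_line (cspan 3 {col A a}) (cspan 3 {col A b}) 
      \<inter> proj_line (cspan 3 {col A c}) (cspan 3 {col A d})"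
    using line_meet_on_lines[OF c nz] by simp
  then have z: "det3 (col A a) (col A b) (col A q) = 0" "det3 (col A c) (col A d) (col A q) = 0"
    using proj_line_det3 c cA[OF q(1)] by auto
  have "col A q \<noteq> 0\<^sub>v 3"
    using on cspan_singleton_in_plane[OF cA[OF q(1)]] by (auto simp: proj_line_def)
  have "det3 (col A a) (col A q) (col A d) \<noteq> 0"
  proof
    assume "det3 (col A a) (col A q) (col A d) = 0"
    then have *: "(det3 (col A a) (col A c) (col A d) * det3 (col A a) (col A b) (col A d)) \<cdot>\<^sub>v col A q = 0 \<cdot>\<^sub>v ?t"
      using line_meet_unique[OF c cA[OF q(1)] z] by simp
    have "col A q $ i = 0" if "i < 3" for i
      using arg_cong[OF *, of "\<lambda>v. v $ i"] that carrier_matD[OF A] nz by (simp add: line_meet_def)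
    moreover have "dim_vec (col A q) = 3" using A by simp
    ultimately have "col A q = 0\<^sub>v 3" by (intro eq_vecI) (simp_all only: index_zero_vec)
    with \<open>col A q \<noteq> 0\<^sub>v 3\<close> show False by simp
  qed
  with z q(1) show ?thesis by (intro bexI[of _ q] conjI) simp_all
qed

section \<open>Quartics from Pascal's theorem\<close>

theorem theorem4p1p1:
  fixes n q :: nat
    and P :: "nat \<Rightarrow> complex vec set"
    and C Q :: "complex vec set set"
    and A :: "complex mat"
    and x :: "complex vec set"
  assumes "n > 6"
    and "inj_on P {1..n}"
    and "nondegenerate_conic C"
    and "P ` {1..n} \<subseteq> C"
    and "Q = (\<Union>i\<in>{6..n}. pascal_points P i)"
    and "q = card Q"
    and "A \<in> carrier_mat 3 (n + q)"
    and "bij_betw (\<lambda>j. cspan 3 {col A j}) {..<n + q} (P ` {1..n} \<union> Q)"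
    and "x = cspan (n + q) (set (rows A))"
  shows "\<exists>S \<subseteq> matroid_ideal 3 (n + q) x.
           card S \<ge> 2 \<and>
           independent_elements 3 (n + q) S \<and>
           (\<forall>f\<in>S. homogeneous 3 (n + q) 4 f \<and> f \<notin> nonbasis_ideal 3 (n + q) x)"
proof -
  let ?m = "n + q"
  note A = \<open>A \<in> carrier_mat 3 (n + q)\<close>
  have points: "(\<lambda>j. cspan 3 {col A j}) ` {..<?m} = P ` {1..n} \<union> Q"
    using assms(8) by (rule bij_betw_imp_surj_on)
  have "\<exists>j<?m. cspan 3 {col A j} = P i" if "i \<in> {1..n}" for i
  proof -
    have "P i \<in> (\<lambda>j. cspan 3 {col A j}) ` {..<?m}" unfolding points using that by (intro UnI1 imageI)
    then show ?thesis by auto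
  qed
  then obtain p where p: "p i < ?m" "cspan 3 {col A (p i)} = P i" if "i \<in> {1..n}" for i by metis
  obtain M where M: "M \<in> carrier_mat 3 3" "M\<^sup>T = M" "det M \<noteq> 0"
    and C: "C = {s \<in> proj_plane. \<forall>v\<in>s. v \<bullet> (M *\<^sub>v v) = 0}"
    using assms(3) unfolding nondegenerate_conic_def by blast
  have cA: "col A (p i) \<in> carrier_vec 3" if "i \<in> {1..n}" for i
    using col_carrier_vec[OF p(1)[OF that] A] .
  have PC: "P i \<in> C" if "i \<in> {1..n}" for i using assms(4) that by auto
  have nz: "col A (p i) \<noteq> 0\<^sub>v 3" if i: "i \<in> {1..n}" for i
    using PC[OF i] cspan_singleton_in_plane[OF cA[OF i]] unfolding p(2)[OF i] C by simp
  have on: "col A (p i) \<bullet> (M *\<^sub>v col A (p i)) = 0" if i: "i \<in> {1..n}" for i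
    using PC[OF i] self_in_cspan[OF cA[OF i]] unfolding p(2)[OF i] C by simp
  have pair: "\<exists>y\<in>carrier_vec 3. det3 (col A (p i)) (col A (p j)) y \<noteq> 0"
    if i: "i \<in> {1..n}" and j: "j \<in> {1..n}" and "i \<noteq> j" for i j
  proof (rule distinct_points_independent[OF cA[OF i] cA[OF j] nz[OF i] nz[OF j]])
    show "cspan 3 {col A (p i)} \<noteq> cspan 3 {col A (p j)}"
      unfolding p(2)[OF i] p(2)[OF j] using assms(2) i j \<open>i \<noteq> j\<close> by (auto dest: inj_onD)
  qed
  have gen: "det3 (col A (p i)) (col A (p j)) (col A (p k)) \<noteq> 0"
    if "{i, j, k} \<subseteq> {1..n}" "distinct [i, j, k]" for i j k
  proof -
    have i: "i \<in> {1..n}" and j: "j \<in> {1..n}" and k: "k \<in> {1..n}"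
      and ne: "i \<noteq> j" "j \<noteq> k" "i \<noteq> k" using that by auto
    show ?thesis
      by (rule conic_points_not_collinear[OF M cA[OF i] cA[OF j] cA[OF k] on[OF i] on[OF j] on[OF k]
            pair[OF i j ne(1)] pair[OF j k ne(2)] pair[OF i k ne(3)]])
  qed
  have five: "1 \<in> {1..n}" "2 \<in> {1..n}" "3 \<in> {1..n}" "4 \<in> {1..n}" "5 \<in> {1..n}"
    using \<open>n > 6\<close> by auto
  have inj: "inj_on p {1..n}"
  proof (rule inj_onI)
    fix i j assume ij: "i \<in> {1..n}" "j \<in> {1..n}" "p i = p j"
    then have "P i = P j" using p(2)[OF ij(1)] p(2)[OF ij(2)] by simp
    then show "i = j" using assms(2) ij by (auto dest: inj_onD)
  qed
  have conic: "conic_quartic (col A (p 1)) (col A (p 2)) (col A (p 3)) (col A (p 4)) (col A (p 5)) (col A (p i)) = 0"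
    if "i \<in> {6..n}" for i
  proof -
    have i: "i \<in> {1..n}" using that by auto
    show ?thesis
      by (rule conic_quartic_vanishes[OF M cA[OF five(1)] cA[OF five(2)] cA[OF five(3)] cA[OF five(4)]
            cA[OF five(5)] cA[OF i] on[OF five(1)] on[OF five(2)] on[OF five(3)] on[OF five(4)]
            on[OF five(5)] on[OF i] gen]) (use \<open>n > 6\<close> in auto)
  qed
  have intersection: "\<exists>s\<in>{..<?m}. det3 (col A (p i)) (col A (p j)) (col A s) = 0 \<and>
      det3 (col A (p k)) (col A (p l)) (col A s) = 0 \<and> det3 (col A (p i)) (col A s) (col A (p l)) \<noteq> 0"
    if "{i, j, k, l} \<subseteq> {1..n}" "distinct [i, j, l]" "distinct [i, k, l]"
      and "proj_line (P i) (P j) \<inter> proj_line (P k) (P l) \<subseteq> Q" for i j k l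
  proof -
    have i: "i \<in> {1..n}" and j: "j \<in> {1..n}" and k: "k \<in> {1..n}" and l: "l \<in> {1..n}"
      using that(1) by auto
    show ?thesis
    proof (rule intersection_column[OF A p(1)[OF i] p(1)[OF j] p(1)[OF k] p(1)[OF l]])
      show "det3 (col A (p i)) (col A (p j)) (col A (p l)) \<noteq> 0"
        "det3 (col A (p i)) (col A (p k)) (col A (p l)) \<noteq> 0"
        using gen[OF _ that(2)] gen[OF _ that(3)] i j k l by simp_all
      show "proj_line (cspan 3 {col A (p i)}) (cspan 3 {col A (p j)}) \<inter>
          proj_line (cspan 3 {col A (p k)}) (cspan 3 {col A (p l)}) \<subseteq> (\<lambda>j. cspan 3 {col A j}) ` {..<?m}"
        unfolding p(2)[OF i] p(2)[OF j] p(2)[OF k] p(2)[OF l] points by (rule le_supI2[OF that(4)])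
    qed
  qed
  have cfg: "\<exists>s\<in>{..<?m}. \<exists>t\<in>{..<?m}. \<exists>u\<in>{..<?m}.
      pascal_config A (p 1) (p 2) (p 3) (p 4) (p 5) (p i) s t u" if i: "i \<in> {6..n}" for i
  proof -
    have i1: "1 \<le> i" "i \<le> n" and ne: "i \<noteq> 1" "i \<noteq> 2" "i \<noteq> 3" "i \<noteq> 4" "i \<noteq> 5" using i by auto
    have sub: "pascal_points P i \<subseteq> Q" unfolding assms(5) using i by blast
    obtain s where s: "s \<in> {..<?m}" "det3 (col A (p 1)) (col A (p 2)) (col A s) = 0"
      "det3 (col A (p 4)) (col A (p 5)) (col A s) = 0" "det3 (col A (p 1)) (col A s) (col A (p 5)) \<noteq> 0"
      using intersection[of 1 2 4 5] sub five unfolding pascal_points_def by auto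
    obtain t where t: "t \<in> {..<?m}" "det3 (col A (p 2)) (col A (p 3)) (col A t) = 0"
      "det3 (col A (p 5)) (col A (p i)) (col A t) = 0" "det3 (col A (p 2)) (col A t) (col A (p i)) \<noteq> 0"
      using intersection[of 2 3 5 i] sub five i1 ne unfolding pascal_points_def by auto
    obtain u where u: "u \<in> {..<?m}" "det3 (col A (p 3)) (col A (p 4)) (col A u) = 0"
      "det3 (col A (p i)) (col A (p 1)) (col A u) = 0" "det3 (col A (p 3)) (col A u) (col A (p 1)) \<noteq> 0"
      using intersection[of 3 4 i 1] sub five i1 ne unfolding pascal_points_def by auto
    have "pascal_config A (p 1) (p 2) (p 3) (p 4) (p 5) (p i) s t u"
      unfolding pascal_config_def Let_def
      by (intro conjI s(2-) t(2-) u(2-) gen) (use five i1 ne in simp_all)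
    with s(1) t(1) u(1) show ?thesis by blast
  qed
  have "represents 3 ?m A x"
    unfolding assms(9)
    by (rule row_space_represents[OF A p(1)[OF five(1)] p(1)[OF five(2)] p(1)[OF five(3)] gen])
      (use five in auto)
  moreover have "VectorSpace.subspace class_ring x (cvec ?m)"
  proof -
    interpret vec_space "TYPE(complex)" ?m .
    have "set (rows A) \<subseteq> carrier_vec ?m" using A by (auto simp: rows_def)
    then show ?thesis unfolding assms(9) by (intro span_is_subspace) simp
  qed
  moreover have "p ` {1..n} \<subseteq> {..<?m}" using p(1) by auto
  ultimately show ?thesis
    using independent_conic_quartics[of n x ?m A p] \<open>n > 6\<close> inj gen conic cfg by blast
qed

end
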